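(* Let $\Bbbk$ be an algebraically closed field of characteristic zero and let $\mathcal{J}$ be the super Jordan plane over $\Bbbk$, with $s=xy+yx$. Then: (1) The set of prime ideals of $\mathcal{J}$ is $$\mathrm{Spec}(\mathcal{J})=\{\langle 0\rangle,\ \langle s,x\rangle\}\cup\{\langle s,x,y-\alpha\rangle\mid \alpha\in\Bbbk\}.$$ (2) Every nonzero prime ideal of $\mathcal{J}$ is completely prime. (3) The set of primitive ideals of $\mathcal{J}$ is $\mathrm{Prim}(\mathcal{J})=\{\langle 0\rangle\}\cup\{\langle s,x,y-\alpha\rangle\mid\alpha\in\Bbbk\}$. (4) The set of maximal (two-sided) ideals of $\mathcal{J}$ is $\mathrm{Max}(\mathcal{J})=\{\langle s,x,y-\alpha\rangle\mid\alpha\in\Bbbk\}$.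
   Context: The super Jordan plane $\mathcal{J}$ over a field $\Bbbk$ is the unital associative $\Bbbk$-algebra generated by $x,y$ with defining relations $x^2=0$ and $y^2x-xy^2-xyx=0$. Put $s:=xy+yx$. $\langle a_1,\dots,a_n\rangle$ denotes the two-sided ideal generated by $a_1,\dots,a_n$. A proper ideal $\mathfrak{p}$ of a ring $R$ is prime if for all two-sided ideals $\mathfrak{a},\mathfrak{b}$, $\mathfrak{a}\mathfrak{b}\subseteq\mathfrak{p}$ implies $\mathfrak{a}\subseteq\mathfrak{p}$ or $\mathfrak{b}\subseteq\mathfrak{p}$; a prime ideal $\mathfrak p$ is completely prime if $R/\mathfrak{p}$ is a domain. An ideal is primitive if it is the annihilator of some simple left $R$-module. *)

theory Defs
  imports
    "HOL-Library.Poly_Mapping"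
    "HOL-Computational_Algebra.Polynomial"
    "HOL-Algebra.Ideal_Product"
    "HOL-Algebra.QuotRing"
    "HOL-Algebra.Module"
    "HOL-Algebra.Algebraic_Closure_Type"
begin

section \<open>Prime, completely prime and primitive ideals of noncommutative rings\<close>

text \<open>
  The predicates \<open>ideal\<close> and \<open>maximalideal\<close> of HOL-Algebra are about two-sided ideals of arbitrary
  rings. In contrast, \<open>primeideal\<close>, \<open>domain\<close> and \<open>module\<close> presuppose a commutative ring, so
  noncommutative versions are introduced here.
\<close>

definition prime_ideal :: "('a, 'b) ring_scheme \<Rightarrow> 'a set \<Rightarrow> bool" where
  "prime_ideal R P \<longleftrightarrow> ideal P R \<and> P \<noteq> carrier R \<and>
     (\<forall>A B. ideal A R \<longrightarrow> ideal B R \<longrightarrow> A \<cdot>\<^bsub>R\<^esub> B \<subseteq> P \<longrightarrow> A \<subseteq> P \<or> B \<subseteq> P)"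

definition noncomm_domain :: "('a, 'b) ring_scheme \<Rightarrow> bool" where
  "noncomm_domain R \<longleftrightarrow> ring R \<and> \<one>\<^bsub>R\<^esub> \<noteq> \<zero>\<^bsub>R\<^esub> \<and>
     (\<forall>a\<in>carrier R. \<forall>b\<in>carrier R. a \<otimes>\<^bsub>R\<^esub> b = \<zero>\<^bsub>R\<^esub> \<longrightarrow> a = \<zero>\<^bsub>R\<^esub> \<or> b = \<zero>\<^bsub>R\<^esub>)"

definition completely_prime_ideal :: "('a, 'b) ring_scheme \<Rightarrow> 'a set \<Rightarrow> bool" where
  "completely_prime_ideal R P \<longleftrightarrow> prime_ideal R P \<and> noncomm_domain (R Quot P)"

locale left_module = R?: ring R + M?: abelian_group M
  for R :: "('a, 'b) ring_scheme" (structure) and M :: "('a, 'm, 'c) module_scheme" (structure) +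
  assumes smult_closed:
      "\<lbrakk>a \<in> carrier R; m \<in> carrier M\<rbrakk> \<Longrightarrow> a \<odot>\<^bsub>M\<^esub> m \<in> carrier M"
    and smult_l_distr:
      "\<lbrakk>a \<in> carrier R; b \<in> carrier R; m \<in> carrier M\<rbrakk> \<Longrightarrow>
        (a \<oplus> b) \<odot>\<^bsub>M\<^esub> m = a \<odot>\<^bsub>M\<^esub> m \<oplus>\<^bsub>M\<^esub> b \<odot>\<^bsub>M\<^esub> m"
    and smult_r_distr:
      "\<lbrakk>a \<in> carrier R; m \<in> carrier M; n \<in> carrier M\<rbrakk> \<Longrightarrow>
        a \<odot>\<^bsub>M\<^esub> (m \<oplus>\<^bsub>M\<^esub> n) = a \<odot>\<^bsub>M\<^esub> m \<oplus>\<^bsub>M\<^esub> a \<odot>\<^bsub>M\<^esub> n"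
    and smult_assoc:
      "\<lbrakk>a \<in> carrier R; b \<in> carrier R; m \<in> carrier M\<rbrakk> \<Longrightarrow>
        (a \<otimes> b) \<odot>\<^bsub>M\<^esub> m = a \<odot>\<^bsub>M\<^esub> (b \<odot>\<^bsub>M\<^esub> m)"
    and smult_one:
      "m \<in> carrier M \<Longrightarrow> \<one> \<odot>\<^bsub>M\<^esub> m = m"

locale simple_left_module = left_module +
  assumes nontrivial: "carrier M \<noteq> {\<zero>\<^bsub>M\<^esub>}"
    and simple: "submodule N R M \<Longrightarrow> N = {\<zero>\<^bsub>M\<^esub>} \<or> N = carrier M"

definition annihilator :: "('a, 'b) ring_scheme \<Rightarrow> ('a, 'm, 'c) module_scheme \<Rightarrow> 'a set" where
  "annihilator R M = {a \<in> carrier R. \<forall>m\<in>carrier M. a \<odot>\<^bsub>M\<^esub> m = \<zero>\<^bsub>M\<^esub>}"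

text \<open>
  HOL cannot quantify existentially over the type of module elements, so the modules below are taken
  to have elements of type \<^typ>\<open>'a set\<close>. This is no restriction: a simple left module is isomorphic
  to the quotient of \<open>R\<close> by a left ideal, whose elements are cosets. See
  \<open>primitive_ideal_annihilator\<close> below.
\<close>

definition primitive_ideal :: "('a, 'b) ring_scheme \<Rightarrow> 'a set \<Rightarrow> bool" where
  "primitive_ideal R P \<longleftrightarrow>
     (\<exists>M :: ('a, 'a set) module. simple_left_module R M \<and> P = annihilator R M)"

definition prime_spectrum :: "('a, 'b) ring_scheme \<Rightarrow> 'a set set" where
  "prime_spectrum R = {P. prime_ideal R P}"

definition primitive_spectrum :: "('a, 'b) ring_scheme \<Rightarrow> 'a set set" where
  "primitive_spectrum R = {P. primitive_ideal R P}"

definition maximal_spectrum :: "('a, 'b) ring_scheme \<Rightarrow> 'a set set" where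
  "maximal_spectrum R = {P. maximalideal P R}"

context left_module
begin

lemma smult_zero: "a \<in> carrier R \<Longrightarrow> a \<odot>\<^bsub>M\<^esub> \<zero>\<^bsub>M\<^esub> = \<zero>\<^bsub>M\<^esub>"
  by (metis M.add.l_cancel_one M.zero_closed M.l_zero smult_closed smult_r_distr)

lemma zero_smult: "m \<in> carrier M \<Longrightarrow> \<zero> \<odot>\<^bsub>M\<^esub> m = \<zero>\<^bsub>M\<^esub>"
  by (metis M.add.l_cancel_one R.zero_closed R.l_zero smult_closed smult_l_distr)

lemma smult_minus:
  assumes "a \<in> carrier R" "m \<in> carrier M"
  shows "a \<odot>\<^bsub>M\<^esub> (\<ominus>\<^bsub>M\<^esub> m) = \<ominus>\<^bsub>M\<^esub> (a \<odot>\<^bsub>M\<^esub> m)"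
proof -
  have "a \<odot>\<^bsub>M\<^esub> m \<oplus>\<^bsub>M\<^esub> a \<odot>\<^bsub>M\<^esub> (\<ominus>\<^bsub>M\<^esub> m) = \<zero>\<^bsub>M\<^esub>"
    using assms by (metis M.a_inv_closed M.r_neg smult_r_distr smult_zero)
  then show ?thesis
    using assms by (metis M.a_inv_closed M.minus_equality M.a_comm smult_closed)
qed

lemma minus_smult:
  assumes "a \<in> carrier R" "m \<in> carrier M"
  shows "(\<ominus> a) \<odot>\<^bsub>M\<^esub> m = \<ominus>\<^bsub>M\<^esub> (a \<odot>\<^bsub>M\<^esub> m)"
proof -
  have "a \<odot>\<^bsub>M\<^esub> m \<oplus>\<^bsub>M\<^esub> (\<ominus> a) \<odot>\<^bsub>M\<^esub> m = \<zero>\<^bsub>M\<^esub>"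
    using assms by (metis R.a_inv_closed R.r_neg smult_l_distr zero_smult)
  then show ?thesis
    using assms by (metis R.a_inv_closed M.minus_equality M.a_comm smult_closed)
qed

lemma submoduleI:
  assumes "N \<subseteq> carrier M" "\<zero>\<^bsub>M\<^esub> \<in> N"
    and "\<And>m. m \<in> N \<Longrightarrow> \<ominus>\<^bsub>M\<^esub> m \<in> N"
    and "\<And>m n. \<lbrakk>m \<in> N; n \<in> N\<rbrakk> \<Longrightarrow> m \<oplus>\<^bsub>M\<^esub> n \<in> N"
    and "\<And>a m. \<lbrakk>a \<in> carrier R; m \<in> N\<rbrakk> \<Longrightarrow> a \<odot>\<^bsub>M\<^esub> m \<in> N"
  shows "submodule N R M"
  using assms
  by (intro submodule.intro subgroup.intro submodule_axioms.intro) (auto simp: a_inv_def)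

end

lemma (in simple_left_module) cyclic:
  assumes m: "m \<in> carrier M" "m \<noteq> \<zero>\<^bsub>M\<^esub>"
  shows "(\<lambda>a. a \<odot>\<^bsub>M\<^esub> m) ` carrier R = carrier M"
proof -
  let ?N = "(\<lambda>a. a \<odot>\<^bsub>M\<^esub> m) ` carrier R"
  have "submodule ?N R M"
  proof (rule submoduleI)
    show "?N \<subseteq> carrier M" using m smult_closed by auto
    show "\<zero>\<^bsub>M\<^esub> \<in> ?N" using zero_smult[OF m(1)] by (metis R.zero_closed image_eqI)
  next
    fix n assume "n \<in> ?N"
    then obtain a where "a \<in> carrier R" "n = a \<odot>\<^bsub>M\<^esub> m" by auto
    then show "\<ominus>\<^bsub>M\<^esub> n \<in> ?N" using m by (auto simp: minus_smult[symmetric])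
  next
    fix n n' assume "n \<in> ?N" "n' \<in> ?N"
    then obtain a b where "a \<in> carrier R" "b \<in> carrier R" "n = a \<odot>\<^bsub>M\<^esub> m" "n' = b \<odot>\<^bsub>M\<^esub> m" by auto
    then show "n \<oplus>\<^bsub>M\<^esub> n' \<in> ?N" using m by (auto simp: smult_l_distr[symmetric])
  next
    fix a n assume "a \<in> carrier R" "n \<in> ?N"
    then show "a \<odot>\<^bsub>M\<^esub> n \<in> ?N" using m by (auto simp: smult_assoc[symmetric])
  qed
  moreover have "m \<in> ?N" using smult_one[OF m(1)] by (metis R.one_closed image_eqI)
  ultimately show ?thesis using simple m by blast
qed

lemma (in simple_left_module) inj_image_simple:
  fixes f :: "_ \<Rightarrow> 'n"
  assumes f: "inj_on f (carrier M)"
  shows "\<exists>M' :: (_, 'n) module. simple_left_module R M' \<and> annihilator R M' = annihilator R M"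
proof -
  define g where "g = inv_into (carrier M) f"
  have gf [simp]: "g (f m) = m" if "m \<in> carrier M" for m
    unfolding g_def using f that by (rule inv_into_f_f)
  define M' :: "(_, 'n) module" where
    "M' = \<lparr>carrier = f ` carrier M, monoid.mult = (\<lambda>u v. u), one = f \<zero>\<^bsub>M\<^esub>,
           ring.zero = f \<zero>\<^bsub>M\<^esub>, add = (\<lambda>u v. f (g u \<oplus>\<^bsub>M\<^esub> g v)), module.smult = (\<lambda>a u. f (a \<odot>\<^bsub>M\<^esub> g u))\<rparr>"
  have M'_simps: "carrier M' = f ` carrier M" "\<zero>\<^bsub>M'\<^esub> = f \<zero>\<^bsub>M\<^esub>"
      "u \<oplus>\<^bsub>M'\<^esub> v = f (g u \<oplus>\<^bsub>M\<^esub> g v)" "a \<odot>\<^bsub>M'\<^esub> u = f (a \<odot>\<^bsub>M\<^esub> g u)" for u v a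
    by (simp_all add: M'_def)
  have grp: "abelian_group M'"
  proof (rule abelian_groupI)
    fix u assume "u \<in> carrier M'"
    then obtain m where m: "m \<in> carrier M" "u = f m" by (auto simp: M'_simps)
    have "f (\<ominus>\<^bsub>M\<^esub> m) \<oplus>\<^bsub>M'\<^esub> u = \<zero>\<^bsub>M'\<^esub>" using m by (simp add: M'_simps M.l_neg)
    then show "\<exists>v\<in>carrier M'. v \<oplus>\<^bsub>M'\<^esub> u = \<zero>\<^bsub>M'\<^esub>" using m by (auto simp: M'_simps)
  qed (auto simp: M'_simps M.a_ac)
  interpret M': left_module R M'
    by (intro left_module.intro left_module_axioms.intro grp R.ring_axioms)
      (auto simp: M'_simps smult_closed smult_l_distr smult_r_distr smult_assoc smult_one)
  have "simple_left_module R M'"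
  proof (intro simple_left_module.intro simple_left_module_axioms.intro M'.left_module_axioms)
    show "carrier M' \<noteq> {\<zero>\<^bsub>M'\<^esub>}"
    proof
      assume "carrier M' = {\<zero>\<^bsub>M'\<^esub>}"
      then have "f m = f \<zero>\<^bsub>M\<^esub>" if "m \<in> carrier M" for m
        using that by (auto simp: M'_simps)
      then have "m = \<zero>\<^bsub>M\<^esub>" if "m \<in> carrier M" for m
        using that f by (meson M.zero_closed inj_onD)
      with nontrivial show False by auto
    qed
  next
    fix N assume "submodule N R M'"
    then have N: "subgroup N (add_monoid M')"
      and N_smult: "\<forall>a\<in>carrier R. \<forall>u\<in>N. a \<odot>\<^bsub>M'\<^esub> u \<in> N"
      by (auto simp: submodule_def submodule_axioms_def)
    have sub: "N \<subseteq> f ` carrier M"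
      using subgroup.subset[OF N] unfolding M'_def by simp
    have fg: "f (g u) = u" and gc: "g u \<in> carrier M" if u: "u \<in> N" for u
    proof -
      obtain n where n: "u = f n" "n \<in> carrier M" using subsetD[OF sub u] by (rule imageE)
      show "f (g u) = u" "g u \<in> carrier M" using n by simp_all
    qed
    have "submodule (g ` N) R M"
    proof (rule submoduleI)
      show "g ` N \<subseteq> carrier M" using gc by auto
      have "f \<zero>\<^bsub>M\<^esub> \<in> N" using subgroup.one_closed[OF N] by (simp add: M'_simps)
      then have "g (f \<zero>\<^bsub>M\<^esub>) \<in> g ` N" by (rule imageI)
      then show "\<zero>\<^bsub>M\<^esub> \<in> g ` N" by simp
    next
      fix m n assume "m \<in> g ` N" "n \<in> g ` N"
      then obtain u v where uv: "u \<in> N" "v \<in> N" "m = g u" "n = g v" by auto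
      have "u \<oplus>\<^bsub>M'\<^esub> v \<in> N" using subgroup.m_closed[OF N] uv by simp
      then have "f (m \<oplus>\<^bsub>M\<^esub> n) \<in> N" using uv by (simp add: M'_simps)
      then have "g (f (m \<oplus>\<^bsub>M\<^esub> n)) \<in> g ` N" by (rule imageI)
      then show "m \<oplus>\<^bsub>M\<^esub> n \<in> g ` N" using uv gc by simp
    next
      fix a m assume am: "a \<in> carrier R" "m \<in> g ` N"
      then obtain u where u: "u \<in> N" "m = g u" by auto
      have "a \<odot>\<^bsub>M'\<^esub> u \<in> N" using N_smult am u by simp
      then have "f (a \<odot>\<^bsub>M\<^esub> m) \<in> N" using u by (simp add: M'_simps)
      then have "g (f (a \<odot>\<^bsub>M\<^esub> m)) \<in> g ` N" by (rule imageI)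
      then show "a \<odot>\<^bsub>M\<^esub> m \<in> g ` N" using u gc am smult_closed by simp
    next
      fix m assume "m \<in> g ` N"
      then obtain u where u: "u \<in> N" "m = g u" by auto
      have "(\<ominus> \<one>) \<odot>\<^bsub>M'\<^esub> u \<in> N" using N_smult u by simp
      then have "f (\<ominus>\<^bsub>M\<^esub> m) \<in> N"
        using u gc by (simp add: M'_simps minus_smult smult_one)
      then have "g (f (\<ominus>\<^bsub>M\<^esub> m)) \<in> g ` N" by (rule imageI)
      then show "\<ominus>\<^bsub>M\<^esub> m \<in> g ` N" using u gc by simp
    qed
    then have "g ` N = {\<zero>\<^bsub>M\<^esub>} \<or> g ` N = carrier M" by (rule simple)
    moreover have "f ` g ` N = N" using fg by (simp add: image_image cong: image_cong)
    ultimately show "N = {\<zero>\<^bsub>M'\<^esub>} \<or> N = carrier M'"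
      by (metis M'_simps(1,2) image_empty image_insert)
  qed
  moreover have "annihilator R M' = annihilator R M"
    using f by (auto simp: annihilator_def M'_simps smult_closed inj_on_eq_iff)
  ultimately show ?thesis by blast
qed

lemma primitive_ideal_annihilator:
  fixes R :: "('a, 'b) ring_scheme" and M :: "('a, 'm, 'c) module_scheme"
  assumes "simple_left_module R M"
  shows "primitive_ideal R (annihilator R M)"
proof -
  interpret simple_left_module R M by fact
  obtain m where m: "m \<in> carrier M" "m \<noteq> \<zero>\<^bsub>M\<^esub>"
    using nontrivial by auto
  have "inj_on (\<lambda>n. {a \<in> carrier R. a \<odot>\<^bsub>M\<^esub> m = n}) (carrier M)"
  proof (rule inj_onI)
    fix n n' assume n: "n \<in> carrier M"
      and eq: "{a \<in> carrier R. a \<odot>\<^bsub>M\<^esub> m = n} = {a \<in> carrier R. a \<odot>\<^bsub>M\<^esub> m = n'}"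
    from n have "n \<in> (\<lambda>a. a \<odot>\<^bsub>M\<^esub> m) ` carrier R" by (simp add: cyclic[OF m])
    then obtain a where a: "a \<in> carrier R" "a \<odot>\<^bsub>M\<^esub> m = n" by auto
    then have "a \<in> {a \<in> carrier R. a \<odot>\<^bsub>M\<^esub> m = n'}" unfolding eq[symmetric] by simp
    with a show "n = n'" by simp
  qed
  from inj_image_simple[OF this] show ?thesis
    unfolding primitive_ideal_def by blast
qed


section \<open>The super Jordan plane\<close>

lemma ring_ring_of_type_algebra: "ring (ring_of_type_algebra :: 'a :: ring_1 ring)"
proof -
  have "\<exists>y. x + y = 0" for x :: 'a
    using add.right_inverse by blast
  then show ?thesis
    unfolding ring_of_type_algebra_def using add.right_inverse
    by unfold_locales (auto simp: algebra_simps Units_def)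
qed

text \<open>
  The free algebra on a set of generators is the monoid algebra of the free monoid. The product of
  \<^type>\<open>poly_mapping\<close> is the convolution with respect to an additively written monoid, so
  concatenation of words is written as (noncommutative) addition.
\<close>

datatype 'a free_word = Free_Word "'a list"

instantiation free_word :: (type) monoid_add
begin

definition zero_free_word :: "'a free_word" where
  "zero_free_word = Free_Word []"

fun plus_free_word :: "'a free_word \<Rightarrow> 'a free_word \<Rightarrow> 'a free_word" where
  "Free_Word u + Free_Word v = Free_Word (u @ v)"

instance
proof
  fix a b c :: "'a free_word"
  show "a + b + c = a + (b + c)" by (cases a; cases b; cases c) simp
  show "0 + a = a" "a + 0 = a" by (cases a; simp add: zero_free_word_def)+
qed

end

datatype sj_gen = Gen_x | Gen_y

type_synonym 'k sj_free_algebra = "sj_gen free_word \<Rightarrow>\<^sub>0 'k"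

definition free_x :: "'k :: field sj_free_algebra" where
  "free_x = Poly_Mapping.single (Free_Word [Gen_x]) 1"

definition free_y :: "'k :: field sj_free_algebra" where
  "free_y = Poly_Mapping.single (Free_Word [Gen_y]) 1"

definition sj_relation_ideal :: "'k :: field sj_free_algebra set" where
  "sj_relation_ideal = Idl\<^bsub>ring_of_type_algebra\<^esub>
     {free_x ^ 2, free_y ^ 2 * free_x - free_x * free_y ^ 2 - free_x * free_y * free_x}"

lemma ideal_sj_relation_ideal:
  "ideal (sj_relation_ideal :: 'k :: field sj_free_algebra set) ring_of_type_algebra"
  unfolding sj_relation_ideal_def
  by (rule ring.genideal_ideal[OF ring_ring_of_type_algebra]) (simp add: ring_of_type_algebra_def)

lemma
  fixes p q :: "'k :: field sj_free_algebra"
  shows sj_relation_ideal_0: "(0 :: 'k sj_free_algebra) \<in> sj_relation_ideal"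
    and sj_relation_ideal_add:
      "p \<in> sj_relation_ideal \<Longrightarrow> q \<in> sj_relation_ideal \<Longrightarrow> p + q \<in> sj_relation_ideal"
    and sj_relation_ideal_mult_left: "p \<in> sj_relation_ideal \<Longrightarrow> q * p \<in> sj_relation_ideal"
    and sj_relation_ideal_mult_right: "p \<in> sj_relation_ideal \<Longrightarrow> p * q \<in> sj_relation_ideal"
proof -
  interpret I: ideal "sj_relation_ideal :: 'k sj_free_algebra set" ring_of_type_algebra
    by (rule ideal_sj_relation_ideal)
  show "(0 :: 'k sj_free_algebra) \<in> sj_relation_ideal"
    using additive_subgroup.zero_closed[OF I.is_additive_subgroup] by (simp add: ring_of_type_algebra_def)
  show "p \<in> sj_relation_ideal \<Longrightarrow> q \<in> sj_relation_ideal \<Longrightarrow> p + q \<in> sj_relation_ideal"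
    using additive_subgroup.a_closed[OF I.is_additive_subgroup, of p q] by (simp add: ring_of_type_algebra_def)
  show "p \<in> sj_relation_ideal \<Longrightarrow> q * p \<in> sj_relation_ideal"
    using I.I_l_closed[of p q] by (simp add: ring_of_type_algebra_def)
  show "p \<in> sj_relation_ideal \<Longrightarrow> p * q \<in> sj_relation_ideal"
    using I.I_r_closed[of p q] by (simp add: ring_of_type_algebra_def)
qed

lemma sj_relation_ideal_uminus: "p \<in> sj_relation_ideal \<Longrightarrow> - p \<in> sj_relation_ideal"
  using sj_relation_ideal_mult_left[of p "- 1"] by simp

lemma free_word_add_eq_0_iff: "(u :: 'a free_word) + v = 0 \<longleftrightarrow> u = 0 \<and> v = 0"
  by (cases u; cases v) (auto simp: zero_free_word_def)

lemma lookup_mult_0: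
  "Poly_Mapping.lookup (p * q) 0 = Poly_Mapping.lookup p 0 * Poly_Mapping.lookup q (0 :: 'a free_word)"
  for p q :: "'a free_word \<Rightarrow>\<^sub>0 'k :: field"
proof -
  have "Poly_Mapping.lookup (p * q) 0 = (\<Sum>u. Poly_Mapping.lookup p u * (\<Sum>v. Poly_Mapping.lookup q v when 0 = u + v))"
    by (rule lookup_mult)
  also have "\<dots> = (\<Sum>u. Poly_Mapping.lookup p u * (\<Sum>v. (Poly_Mapping.lookup q v when v = 0) when u = 0))"
    by (intro Sum_any.cong arg_cong2[of _ _ _ _ "(*)"] refl)
      (auto simp: when_def free_word_add_eq_0_iff eq_commute[of 0])
  also have "\<dots> = (\<Sum>u. (Poly_Mapping.lookup p u * Poly_Mapping.lookup q 0) when u = 0)"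
    by (intro Sum_any.cong) (auto simp: when_def)
  also have "\<dots> = Poly_Mapping.lookup p 0 * Poly_Mapping.lookup q 0"
    by simp
  finally show ?thesis .
qed

text \<open>
  The relations have no constant term, hence the relation ideal lies in the augmentation ideal of
  the free algebra. This is used to show that \<open>0 \<noteq> 1\<close> in the quotient.
\<close>

lemma sj_relation_ideal_lookup_0: "p \<in> sj_relation_ideal \<Longrightarrow> Poly_Mapping.lookup p 0 = 0"
  for p :: "'k :: field sj_free_algebra"
proof -
  let ?I = "{p :: 'k sj_free_algebra. Poly_Mapping.lookup p 0 = 0}"
  let ?R = "ring_of_type_algebra :: 'k sj_free_algebra ring"
  interpret R: ring ?R by (rule ring_ring_of_type_algebra)
  have sub: "subgroup ?I (add_monoid ?R)"
  proof (rule subgroup.intro)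
    fix q assume q: "q \<in> ?I"
    have "inv\<^bsub>add_monoid ?R\<^esub> q = - q"
      using R.minus_equality[of "- q" q] by (simp add: ring_of_type_algebra_def a_inv_def)
    with q show "inv\<^bsub>add_monoid ?R\<^esub> q \<in> ?I" by simp
  qed (auto simp: ring_of_type_algebra_def lookup_add)
  have "ideal ?I ?R"
    by (rule idealI[OF R.ring_axioms sub]) (auto simp: ring_of_type_algebra_def lookup_mult_0)
  moreover have "Poly_Mapping.lookup (free_x :: 'k sj_free_algebra) 0 = 0"
    by (simp add: free_x_def lookup_single zero_free_word_def)
  ultimately have "sj_relation_ideal \<subseteq> ?I"
    unfolding sj_relation_ideal_def
    by (intro R.genideal_minimal) (auto simp: lookup_mult_0 lookup_minus power2_eq_square)
  then show "p \<in> sj_relation_ideal \<Longrightarrow> Poly_Mapping.lookup p 0 = 0" by blast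
qed

definition sj_cong :: "'k :: field sj_free_algebra \<Rightarrow> 'k sj_free_algebra \<Rightarrow> bool" where
  "sj_cong p q \<longleftrightarrow> p - q \<in> sj_relation_ideal"

lemma equivp_sj_cong: "equivp (sj_cong :: 'a :: field sj_free_algebra \<Rightarrow> _)"
proof (rule equivpI)
  show "reflp (sj_cong :: 'a sj_free_algebra \<Rightarrow> _)"
    by (simp add: reflp_def sj_cong_def sj_relation_ideal_0)
  show "symp (sj_cong :: 'a sj_free_algebra \<Rightarrow> _)"
    unfolding symp_def sj_cong_def by (metis minus_diff_eq sj_relation_ideal_uminus)
  show "transp (sj_cong :: 'a sj_free_algebra \<Rightarrow> _)"
  proof (rule transpI, unfold sj_cong_def)
    fix p q r :: "'a sj_free_algebra"
    assume "p - q \<in> sj_relation_ideal" "q - r \<in> sj_relation_ideal"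
    from sj_relation_ideal_add[OF this] show "p - r \<in> sj_relation_ideal" by simp
  qed
qed

quotient_type (overloaded) 'k super_jordan = "'k :: field sj_free_algebra" / sj_cong
  by (rule equivp_sj_cong)

instantiation super_jordan :: (field) ring_1
begin

lift_definition zero_super_jordan :: "'a super_jordan" is 0 .

lift_definition one_super_jordan :: "'a super_jordan" is 1 .

lift_definition plus_super_jordan :: "'a super_jordan \<Rightarrow> 'a super_jordan \<Rightarrow> 'a super_jordan" is "(+)"
proof -
  fix p p' q q' :: "'a sj_free_algebra"
  assume "sj_cong p p'" "sj_cong q q'"
  then have "(p - p') + (q - q') \<in> sj_relation_ideal"
    unfolding sj_cong_def by (rule sj_relation_ideal_add)
  then show "sj_cong (p + q) (p' + q')"
    by (simp add: sj_cong_def add_diff_add)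
qed

lift_definition uminus_super_jordan :: "'a super_jordan \<Rightarrow> 'a super_jordan" is uminus
proof -
  fix p p' :: "'a sj_free_algebra"
  assume "sj_cong p p'"
  then have "- (p - p') \<in> sj_relation_ideal"
    unfolding sj_cong_def by (rule sj_relation_ideal_uminus)
  then show "sj_cong (- p) (- p')"
    by (simp add: sj_cong_def)
qed

lift_definition minus_super_jordan :: "'a super_jordan \<Rightarrow> 'a super_jordan \<Rightarrow> 'a super_jordan" is "(-)"
proof -
  fix p p' q q' :: "'a sj_free_algebra"
  assume "sj_cong p p'" "sj_cong q q'"
  then have "(p - p') + - (q - q') \<in> sj_relation_ideal"
    unfolding sj_cong_def by (intro sj_relation_ideal_add sj_relation_ideal_uminus)
  then show "sj_cong (p - q) (p' - q')"
    by (simp add: sj_cong_def algebra_simps)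
qed

lift_definition times_super_jordan :: "'a super_jordan \<Rightarrow> 'a super_jordan \<Rightarrow> 'a super_jordan" is "(*)"
proof -
  fix p p' q q' :: "'a sj_free_algebra"
  assume "sj_cong p p'" "sj_cong q q'"
  then have "(p - p') * q + p' * (q - q') \<in> sj_relation_ideal"
    unfolding sj_cong_def
    by (intro sj_relation_ideal_add sj_relation_ideal_mult_left sj_relation_ideal_mult_right)
  then show "sj_cong (p * q) (p' * q')"
    by (simp add: sj_cong_def algebra_simps)
qed

instance
proof
  fix a b c :: "'a super_jordan"
  show "a * b * c = a * (b * c)"
    by transfer (simp add: sj_cong_def sj_relation_ideal_0 mult.assoc)
  show "1 * a = a" "a * 1 = a" "0 + a = a" "- a + a = 0" "a - b = a + - b"
    by (transfer; simp add: sj_cong_def sj_relation_ideal_0)+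
  show "a + b + c = a + (b + c)" "a + b = b + a"
    by (transfer; simp add: sj_cong_def sj_relation_ideal_0 add_ac)+
  show "(a + b) * c = a * c + b * c" "a * (b + c) = a * b + a * c"
    by (transfer; simp add: sj_cong_def sj_relation_ideal_0 distrib_left distrib_right)+
  show "(0 :: 'a super_jordan) \<noteq> 1"
  proof (transfer, unfold sj_cong_def, rule notI)
    assume "(0 :: 'a sj_free_algebra) - 1 \<in> sj_relation_ideal"
    then have "Poly_Mapping.lookup ((0 :: 'a sj_free_algebra) - 1) 0 = 0"
      using sj_relation_ideal_lookup_0 by blast
    then show False by (simp add: lookup_minus)
  qed
qed

end

lift_definition sj_x :: "'k :: field super_jordan" is free_x .

lift_definition sj_y :: "'k :: field super_jordan" is free_y .

lift_definition sj_const :: "'k :: field \<Rightarrow> 'k super_jordan" is "Poly_Mapping.single 0" .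

definition sj_s :: "'k :: field super_jordan" where
  "sj_s = sj_x * sj_y + sj_y * sj_x"

lemma sj_relations:
  "sj_x ^ 2 = (0 :: 'k :: field super_jordan)"
  "sj_y ^ 2 * sj_x - sj_x * sj_y ^ 2 - sj_x * sj_y * sj_x = (0 :: 'k :: field super_jordan)"
proof -
  have gen: "{free_x ^ 2, free_y ^ 2 * free_x - free_x * free_y ^ 2 - free_x * free_y * free_x}
      \<subseteq> (sj_relation_ideal :: 'k sj_free_algebra set)"
    unfolding sj_relation_ideal_def
    by (rule ring.genideal_self[OF ring_ring_of_type_algebra]) (simp add: ring_of_type_algebra_def)
  show "sj_x ^ 2 = (0 :: 'k super_jordan)"
    unfolding power2_eq_square
    by transfer (use gen in \<open>simp add: sj_cong_def power2_eq_square\<close>)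
  show "sj_y ^ 2 * sj_x - sj_x * sj_y ^ 2 - sj_x * sj_y * sj_x = (0 :: 'k super_jordan)"
    unfolding power2_eq_square
    by transfer (use gen in \<open>simp add: sj_cong_def power2_eq_square\<close>)
qed

definition super_jordan_plane :: "'k :: field super_jordan ring" where
  "super_jordan_plane = ring_of_type_algebra"

end

(*
  Put z = y^2. The subalgebra B generated by s and z is a Jordan plane, zs = sz + s^2, it satisfies
  Bx = xB, and J = B + xB + yB + xyB. Starting from a nonzero element of a two-sided ideal I,
  multiplication by x yields a nonzero element xb of I with b in B; commutators with s lower the
  degree of b in z, commutators with z then remove all but one power of s (both need characteristic
  zero), and anticommuting x s^k with y shows that s^(k+1) lies in I. So every nonzero ideal contains
  a power of s. As s is normal, a nonzero prime contains s, and then also the normal element x of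
  J/(s); what remains is Spec k[y]. The ideal 0 is primitive, hence prime, because J acts on k[u]^2
  simply and with s invertible.
*)

theory Submission
  imports Defs "HOL-Library.Product_Plus"
begin

section \<open>Ideals of noncommutative rings\<close>

text \<open>No basis of J is established. Each descent tracks a coefficient polynomial that is
  nonzero in \<open>'k poly\<close>, rather than a nonzero element of J: if
  \<open>x (f(s) z^n + lower terms)\<close> lies in an ideal and \<open>f\<close> is nonzero, then a
  power of \<open>s\<close> lies there, whether or not the displayed element vanishes. The fact left
  over, that no power of \<open>s\<close> is zero, comes from the module, and the same descent
  applied to its annihilator shows that it is faithful. The module arises by inverting
  \<open>s\<close>. With u = z s^(-1) the relation z s = s z + s^2 becomes u s = s u + s, so on
  polynomials in u the element \<open>s\<close> can act as f(u) -> f(u - 1). There are two copies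
  because \<open>y\<close> is a square root of \<open>z\<close> that interchanges them, while
  \<open>x\<close>, of square zero, maps the second to the first. Characteristic zero enters here
  once more: a shift-invariant polynomial is constant. Algebraic closedness serves to split
  polynomials in \<open>y\<close> into linear factors.\<close>

lemma ring_of_type_algebra_simps [simp]:
  "carrier ring_of_type_algebra = (UNIV :: 'a :: ring_1 set)"
  "monoid.mult ring_of_type_algebra = ((*) :: 'a \<Rightarrow> 'a \<Rightarrow> 'a)"
  "monoid.one ring_of_type_algebra = (1 :: 'a)"
  "ring.zero ring_of_type_algebra = (0 :: 'a)"
  "ring.add ring_of_type_algebra = ((+) :: 'a \<Rightarrow> 'a \<Rightarrow> 'a)"
  by (simp_all add: ring_of_type_algebra_def)

lemma a_inv_ring_of_type_algebra: "\<ominus>\<^bsub>ring_of_type_algebra\<^esub> a = - (a :: 'a :: ring_1)"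
  using abelian_group.minus_equality[OF ring.is_abelian_group[OF ring_ring_of_type_algebra], of "- a" a]
  by simp

lemma ideal_ring_of_type_algebra_iff:
  "ideal I (ring_of_type_algebra :: 'a :: ring_1 ring) \<longleftrightarrow>
     0 \<in> I \<and> (\<forall>a\<in>I. \<forall>b\<in>I. a + b \<in> I) \<and> (\<forall>a\<in>I. \<forall>r. r * a \<in> I \<and> a * r \<in> I)"
  (is "?L \<longleftrightarrow> ?R")
proof
  assume ?L
  then interpret I: ideal I "ring_of_type_algebra :: 'a ring" .
  show ?R
    using additive_subgroup.a_closed[OF I.is_additive_subgroup]
      additive_subgroup.zero_closed[OF I.is_additive_subgroup] I.I_l_closed I.I_r_closed by auto
next
  assume R: ?R
  have neg: "- a \<in> I" if "a \<in> I" for a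
    using R that by (metis mult_minus1)
  show ?L
  proof (rule idealI[OF ring_ring_of_type_algebra])
    show "subgroup I (add_monoid (ring_of_type_algebra :: 'a ring))"
    proof (rule subgroup.intro)
      fix a assume "a \<in> I"
      then show "inv\<^bsub>add_monoid ring_of_type_algebra\<^esub> a \<in> I"
        using neg a_inv_ring_of_type_algebra[of a] unfolding a_inv_def by simp
    qed (use R in auto)
  qed (use R in auto)
qed

lemma
  assumes "ideal I (ring_of_type_algebra :: 'a :: ring_1 ring)"
  shows ideal_zero: "0 \<in> I"
    and ideal_add: "a \<in> I \<Longrightarrow> b \<in> I \<Longrightarrow> a + b \<in> I"
    and ideal_mult_left: "a \<in> I \<Longrightarrow> r * a \<in> I"
    and ideal_mult_right: "a \<in> I \<Longrightarrow> a * r \<in> I"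
    and ideal_diff: "a \<in> I \<Longrightarrow> b \<in> I \<Longrightarrow> a - b \<in> I"
proof -
  show *: "0 \<in> I" "a \<in> I \<Longrightarrow> b \<in> I \<Longrightarrow> a + b \<in> I" "a \<in> I \<Longrightarrow> r * a \<in> I" "a \<in> I \<Longrightarrow> a * r \<in> I"
      for a b r
    using assms by (auto simp: ideal_ring_of_type_algebra_iff)
  have neg: "- a \<in> I" if "a \<in> I" for a
    using *(3)[OF that, of "- 1"] by simp
  show "a - b \<in> I" if "a \<in> I" "b \<in> I" for a b
    using *(2)[OF that(1) neg[OF that(2)]] by simp
qed

lemma ideal_eq_UNIV_iff:
  assumes "ideal I (ring_of_type_algebra :: 'a :: ring_1 ring)"
  shows "I = UNIV \<longleftrightarrow> 1 \<in> I"
  using ideal_mult_left[OF assms, of 1] by auto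

lemma prime_ideal_iff_elementwise:
  "prime_ideal (ring_of_type_algebra :: 'a :: ring_1 ring) P \<longleftrightarrow>
     ideal P (ring_of_type_algebra :: 'a ring) \<and> P \<noteq> UNIV \<and>
     (\<forall>a b. (\<forall>r. a * r * b \<in> P) \<longrightarrow> a \<in> P \<or> b \<in> P)"
  (is "?L \<longleftrightarrow> ?R")
proof
  assume L: ?L
  then have P: "ideal P (ring_of_type_algebra :: 'a ring)" "P \<noteq> UNIV"
    by (simp_all add: prime_ideal_def)
  have "a \<in> P \<or> b \<in> P" if ab: "\<forall>r. a * r * b \<in> P" for a b
  proof -
    \<comment> \<open>\<open>B\<close> collects what is killed modulo \<open>P\<close> by
      \<open>a r\<close> for all \<open>r\<close>, and \<open>A\<close> what kills \<open>B\<close>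
      in the same sense. Both are two-sided ideals by construction and contain \<open>b\<close> and
      \<open>a\<close>, which replaces a description of the ideals generated by these
      elements.\<close>
    define B where "B = {v. \<forall>r. a * r * v \<in> P}"
    define A where "A = {u. \<forall>r. \<forall>v\<in>B. u * r * v \<in> P}"
    have "ideal B (ring_of_type_algebra :: 'a ring)"
      unfolding ideal_ring_of_type_algebra_iff B_def
      using ideal_zero[OF P(1)] ideal_add[OF P(1)] ideal_mult_right[OF P(1)]
      by (auto simp: distrib_left simp flip: mult.assoc) (metis mult.assoc)
    moreover have "ideal A (ring_of_type_algebra :: 'a ring)"
      unfolding ideal_ring_of_type_algebra_iff A_def
      using ideal_zero[OF P(1)] ideal_add[OF P(1)] ideal_mult_left[OF P(1)]
      by (auto simp: distrib_right mult.assoc) (metis mult.assoc)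
    moreover have "A \<cdot>\<^bsub>ring_of_type_algebra\<^esub> B \<subseteq> P"
    proof
      fix c assume "c \<in> A \<cdot>\<^bsub>ring_of_type_algebra\<^esub> B"
      then show "c \<in> P"
      proof induction
        case (prod u v)
        then have "u * 1 * v \<in> P" unfolding A_def by blast
        then show ?case by simp
      qed (use ideal_add[OF P(1)] in auto)
    qed
    ultimately have "A \<subseteq> P \<or> B \<subseteq> P"
      using L by (simp add: prime_ideal_def)
    moreover have "b \<in> B" "a \<in> A" using ab by (auto simp: A_def B_def)
    ultimately show ?thesis by blast
  qed
  with P show ?R by blast
next
  assume R: ?R
  have "A \<subseteq> P \<or> B \<subseteq> P"
    if A: "ideal A (ring_of_type_algebra :: 'a ring)"
      and AB: "A \<cdot>\<^bsub>ring_of_type_algebra\<^esub> B \<subseteq> P" for A B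
  proof (rule ccontr)
    assume "\<not> ?thesis"
    then obtain a b where ab: "a \<in> A" "a \<notin> P" "b \<in> B" "b \<notin> P" by blast
    have "a * r * b \<in> P" for r
      using ideal_prod.prod[of "a * r" A b B "ring_of_type_algebra :: 'a ring"]
        ideal_mult_right[OF A ab(1)] ab AB by auto
    with R ab show False by blast
  qed
  with R show ?L by (simp add: prime_ideal_def)
qed

text \<open>An ideal not inside \<open>I\<close> contains an element congruent to 1 modulo
  \<open>I\<close>. The product of two such elements is again congruent to 1, so it cannot lie in
  \<open>I\<close>.\<close>

lemma maximalideal_imp_prime_ideal:
  assumes "maximalideal I (ring_of_type_algebra :: 'a :: ring_1 ring)"
  shows "prime_ideal (ring_of_type_algebra :: 'a ring) I"
proof -
  let ?R = "ring_of_type_algebra :: 'a ring"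
  interpret I: maximalideal I ?R by fact
  have I: "ideal I ?R" by (rule I.ideal_axioms)
  have notI: "I \<noteq> UNIV" using I.I_notcarr by auto
  have coprime: "\<exists>a\<in>A. 1 - a \<in> I" if A: "ideal A ?R" "\<not> A \<subseteq> I" for A
  proof -
    let ?S = "{a + p | a p. a \<in> A \<and> p \<in> I}"
    have "ideal ?S ?R"
      unfolding ideal_ring_of_type_algebra_iff
    proof (safe)
      show "\<exists>a p. (0::'a) = a + p \<and> a \<in> A \<and> p \<in> I"
        using ideal_zero[OF A(1)] ideal_zero[OF I] by (metis add.right_neutral)
    next
      fix a p b q assume "a \<in> A" "p \<in> I" "b \<in> A" "q \<in> I"
      then show "\<exists>c r. a + p + (b + q) = c + r \<and> c \<in> A \<and> r \<in> I"
        using ideal_add[OF A(1), of a b] ideal_add[OF I, of p q]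
        by (intro exI[of _ "a + b"] exI[of _ "p + q"]) (auto simp: algebra_simps)
    next
      fix a p r assume "a \<in> A" "p \<in> I"
      then show "\<exists>c q. r * (a + p) = c + q \<and> c \<in> A \<and> q \<in> I"
        "\<exists>c q. (a + p) * r = c + q \<and> c \<in> A \<and> q \<in> I"
        using ideal_mult_left[OF A(1)] ideal_mult_left[OF I]
          ideal_mult_right[OF A(1)] ideal_mult_right[OF I]
        by (metis distrib_left, metis distrib_right)
    qed
    moreover have "I \<subseteq> ?S" using ideal_zero[OF A(1)] by force
    moreover have "A \<subseteq> ?S" using ideal_zero[OF I] by force
    ultimately have "?S = UNIV"
      using I.I_maximal[of ?S] A(2) by auto
    then obtain a p where "1 = a + p" "a \<in> A" "p \<in> I" by blast
    then show ?thesis by (metis add_diff_cancel_left')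
  qed
  have "A \<subseteq> I \<or> B \<subseteq> I"
    if AB: "ideal A ?R" "ideal B ?R" "A \<cdot>\<^bsub>?R\<^esub> B \<subseteq> I" for A B
  proof (rule ccontr)
    assume "\<not> ?thesis"
    with coprime AB obtain a b where ab: "a \<in> A" "b \<in> B" "1 - a \<in> I" "1 - b \<in> I" by meson
    have "a * b \<in> I" using ideal_prod.prod[OF ab(1,2), of ?R] AB(3) by auto
    then have "a * b + (a * (1 - b) + (1 - a)) \<in> I"
      using ab ideal_add[OF I] ideal_mult_left[OF I] by simp
    then have "1 \<in> I" by (simp add: algebra_simps)
    with notI show False using ideal_eq_UNIV_iff[OF I] by simp
  qed
  with notI I show ?thesis by (simp add: prime_ideal_def)
qed

lemma completely_prime_idealI:
  assumes P: "ideal P (ring_of_type_algebra :: 'a :: ring_1 ring)" "1 \<notin> P"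
    and ab: "\<And>a b. a * b \<in> P \<Longrightarrow> a \<in> P \<or> b \<in> P"
  shows "completely_prime_ideal (ring_of_type_algebra :: 'a ring) P"
proof -
  let ?R = "ring_of_type_algebra :: 'a ring"
  interpret P: ideal P ?R by fact
  have "prime_ideal ?R P"
    unfolding prime_ideal_iff_elementwise
    using P ab by (metis UNIV_I mult_1_right)
  moreover have zero_iff: "P +>\<^bsub>?R\<^esub> a = P \<longleftrightarrow> a \<in> P" for a
    using P.a_rcos_const[of a] P.a_rcos_self[of a] by auto
  have "noncomm_domain (?R Quot P)"
    unfolding noncomm_domain_def
  proof (intro conjI ballI impI)
    show "ring (?R Quot P)" by (rule P.quotient_is_ring)
    show "\<one>\<^bsub>?R Quot P\<^esub> \<noteq> \<zero>\<^bsub>?R Quot P\<^esub>"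
      using zero_iff[of 1] P(2) by (simp add: FactRing_def)
  next
    fix U V assume UV: "U \<in> carrier (?R Quot P)" "V \<in> carrier (?R Quot P)"
      and eq: "U \<otimes>\<^bsub>?R Quot P\<^esub> V = \<zero>\<^bsub>?R Quot P\<^esub>"
    from UV obtain a b where U: "U = P +>\<^bsub>?R\<^esub> a" and V: "V = P +>\<^bsub>?R\<^esub> b"
      by (auto simp: FactRing_def A_RCOSETS_def')
    have "P +>\<^bsub>?R\<^esub> (a * b) = P"
      using eq P.rcoset_mult_add[of a b] by (simp add: FactRing_def U V)
    then show "U = \<zero>\<^bsub>?R Quot P\<^esub> \<or> V = \<zero>\<^bsub>?R Quot P\<^esub>"
      using ab zero_iff by (auto simp: FactRing_def U V)
  qed
  ultimately show ?thesis by (simp add: completely_prime_ideal_def)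
qed

text \<open>If \<open>b m\<close> is nonzero for some \<open>b\<close> in \<open>B\<close>, then
  \<open>R b m\<close> is all of \<open>M\<close> by simplicity, and \<open>A M = A R b m\<close>
  vanishes because \<open>R b\<close> lies in \<open>B\<close>.\<close>

lemma (in simple_left_module) prime_ideal_annihilator: "prime_ideal R (annihilator R M)"
  unfolding prime_ideal_def
proof (intro conjI allI impI)
  show "ideal (annihilator R M) R"
  proof (rule idealI[OF R.ring_axioms])
    show "subgroup (annihilator R M) (add_monoid R)"
    proof (rule subgroup.intro)
      fix a assume "a \<in> annihilator R M"
      then have "\<ominus> a \<in> annihilator R M"
        by (auto simp: annihilator_def minus_smult)
      then show "inv\<^bsub>add_monoid R\<^esub> a \<in> annihilator R M"
        by (simp add: a_inv_def)
    qed (auto simp: annihilator_def smult_l_distr zero_smult)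
  qed (auto simp: annihilator_def smult_assoc smult_zero smult_closed)
  obtain m where m: "m \<in> carrier M" "m \<noteq> \<zero>\<^bsub>M\<^esub>"
    using nontrivial by auto
  then have "\<one> \<notin> annihilator R M" by (auto simp: annihilator_def smult_one)
  then show "annihilator R M \<noteq> carrier R" by blast
next
  fix A B assume A: "ideal A R" and B: "ideal B R"
    and AB: "A \<cdot>\<^bsub>R\<^esub> B \<subseteq> annihilator R M"
  interpret A: ideal A R by fact
  interpret B: ideal B R by fact
  have "A \<subseteq> annihilator R M" if notB: "\<not> B \<subseteq> annihilator R M"
  proof
    fix a assume a: "a \<in> A"
    from notB obtain b m where b: "b \<in> B" "m \<in> carrier M" "b \<odot>\<^bsub>M\<^esub> m \<noteq> \<zero>\<^bsub>M\<^esub>"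
      using B.a_subset by (auto simp: annihilator_def)
    then have bc: "b \<in> carrier R" using B.a_subset by blast
    have "a \<odot>\<^bsub>M\<^esub> n = \<zero>\<^bsub>M\<^esub>" if "n \<in> carrier M" for n
    proof -
      from that obtain r where r: "r \<in> carrier R" "n = r \<odot>\<^bsub>M\<^esub> (b \<odot>\<^bsub>M\<^esub> m)"
        using cyclic[of "b \<odot>\<^bsub>M\<^esub> m"] b bc smult_closed by blast
      have "a \<otimes> (r \<otimes> b) \<in> annihilator R M"
        using ideal_prod.prod[OF a B.I_l_closed[OF b(1) r(1)], of R] AB by blast
      then have "(a \<otimes> (r \<otimes> b)) \<odot>\<^bsub>M\<^esub> m = \<zero>\<^bsub>M\<^esub>"
        using b by (simp add: annihilator_def)
      then show ?thesis
        using r b bc a A.a_subset by (auto simp: smult_assoc smult_closed)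
    qed
    then show "a \<in> annihilator R M"
      using a A.a_subset by (auto simp: annihilator_def)
  qed
  then show "A \<subseteq> annihilator R M \<or> B \<subseteq> annihilator R M" by blast
qed

section \<open>Actions of the super Jordan plane\<close>

text \<open>Additive form of \<open>update_induct\<close>: at a fresh key an update is the addition
  of a monomial.\<close>

lemma poly_mapping_induct_add [case_names single add]:
  fixes p :: "'a \<Rightarrow>\<^sub>0 'b :: monoid_add"
  assumes single: "\<And>k c. P (Poly_Mapping.single k c)"
    and add: "\<And>p q. P p \<Longrightarrow> P q \<Longrightarrow> P (p + q)"
  shows "P p"
proof (induction p rule: update_induct)
  case const
  show ?case using single[of undefined 0] by simp
next
  case (update f a b)
  have "Poly_Mapping.update a b f = Poly_Mapping.single a b + f"
  proof (rule poly_mapping_eqI)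
    fix k
    show "Poly_Mapping.lookup (Poly_Mapping.update a b f) k = Poly_Mapping.lookup (Poly_Mapping.single a b + f) k"
      using update(1) by (auto simp: lookup_update lookup_add lookup_single when_def in_keys_iff)
  qed
  then show ?case using update single add by simp
qed

lemma sj_const_0: "sj_const 0 = 0"
  and sj_const_1: "sj_const 1 = 1"
  and sj_const_add: "sj_const (c + d) = sj_const c + sj_const d"
  and sj_const_mult: "sj_const (c * d) = sj_const c * sj_const d"
  for c d :: "'k :: field"
  by (transfer; simp add: equivp_reflp[OF equivp_sj_cong] single_add mult_single)+

lemma sj_const_commute: "sj_const c * a = a * sj_const c"
proof transfer
  fix c and p :: "'k :: field sj_free_algebra"
  have "Poly_Mapping.single 0 c * p = p * Poly_Mapping.single 0 c"
  proof (induction p rule: poly_mapping_induct_add)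
    case (single k d)
    then show ?case by (simp add: mult_single mult.commute)
  qed (simp add: distrib_left distrib_right)
  then show "sj_cong (Poly_Mapping.single 0 c * p) (p * Poly_Mapping.single 0 c)"
    by (simp add: equivp_reflp[OF equivp_sj_cong])
qed

text \<open>Elements are linear combinations of words, and a word grows by one letter on the left. A
  claim closed under sums thus has to be checked only against left multiplication by scalars and
  generators.\<close>

lemma super_jordan_induct [case_names one add const x y]:
  fixes a :: "'k :: field super_jordan"
  assumes one: "P 1"
    and add: "\<And>a b. P a \<Longrightarrow> P b \<Longrightarrow> P (a + b)"
    and const: "\<And>c a. P a \<Longrightarrow> P (sj_const c * a)"
    and x: "\<And>a. P a \<Longrightarrow> P (sj_x * a)"
    and y: "\<And>a. P a \<Longrightarrow> P (sj_y * a)"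
  shows "P a"
proof (induct a rule: super_jordan.abs_induct)
  fix p :: "'k sj_free_algebra"
  have word: "P (abs_super_jordan (Poly_Mapping.single (Free_Word w) 1))" for w
  proof (induction w)
    case Nil
    show ?case using one by (simp add: one_super_jordan.abs_eq single_one flip: zero_free_word_def)
  next
    case (Cons g w)
    have "abs_super_jordan (Poly_Mapping.single (Free_Word (g # w)) (1 :: 'k)) =
        (case g of Gen_x \<Rightarrow> sj_x | Gen_y \<Rightarrow> sj_y) * abs_super_jordan (Poly_Mapping.single (Free_Word w) 1)"
      by (cases g) (simp_all add: sj_x.abs_eq sj_y.abs_eq times_super_jordan.abs_eq free_x_def
          free_y_def mult_single)
    with Cons x y show ?case by (cases g) auto
  qed
  show "P (abs_super_jordan p)"
  proof (induction p rule: poly_mapping_induct_add)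
    case (single k c)
    obtain w where "k = Free_Word w" by (cases k)
    then have "abs_super_jordan (Poly_Mapping.single k c) =
        sj_const c * abs_super_jordan (Poly_Mapping.single (Free_Word w) 1)"
      by (simp add: sj_const.abs_eq times_super_jordan.abs_eq mult_single)
    with word const show ?case by simp
  next
    case (add p q)
    with assms(2) show ?case by (simp flip: plus_super_jordan.abs_eq)
  qed
qed

primrec word_act :: "('v \<Rightarrow> 'v) \<Rightarrow> ('v \<Rightarrow> 'v) \<Rightarrow> sj_gen list \<Rightarrow> 'v \<Rightarrow> 'v" where
  "word_act F G [] v = v"
| "word_act F G (g # w) v = (case g of Gen_x \<Rightarrow> F | Gen_y \<Rightarrow> G) (word_act F G w v)"

lemma word_act_append: "word_act F G (w @ w') v = word_act F G w (word_act F G w' v)"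
  by (induction w) auto

definition free_act ::
  "('k \<Rightarrow> 'v \<Rightarrow> 'v) \<Rightarrow> ('v \<Rightarrow> 'v) \<Rightarrow> ('v \<Rightarrow> 'v) \<Rightarrow> 'k :: field sj_free_algebra \<Rightarrow> 'v \<Rightarrow> 'v :: ab_group_add"
where
  "free_act sc F G p v =
     (\<Sum>w\<in>Poly_Mapping.keys p. sc (Poly_Mapping.lookup p w) (case w of Free_Word u \<Rightarrow> word_act F G u v))"

text \<open>Acts through a chosen representative, so that the definition is total in
  \<open>F\<close> and \<open>G\<close>. Independence of the choice is \<open>act_abs\<close>,
  available once the operators satisfy the defining relations.\<close>

definition sj_act ::
  "('k \<Rightarrow> 'v \<Rightarrow> 'v) \<Rightarrow> ('v \<Rightarrow> 'v) \<Rightarrow> ('v \<Rightarrow> 'v) \<Rightarrow> 'k :: field super_jordan \<Rightarrow> 'v \<Rightarrow> 'v :: ab_group_add"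
where "sj_act sc F G a = free_act sc F G (rep_super_jordan a)"

locale sj_action =
  fixes sc :: "'k :: field \<Rightarrow> 'v :: ab_group_add \<Rightarrow> 'v" and F G :: "'v \<Rightarrow> 'v"
  assumes sc_add_right: "sc c (v + w) = sc c v + sc c w"
    and sc_add_left: "sc (c + d) v = sc c v + sc d v"
    and sc_mult: "sc (c * d) v = sc c (sc d v)"
    and sc_one: "sc 1 v = v"
    and F_add: "F (v + w) = F v + F w" and F_sc: "F (sc c v) = sc c (F v)"
    and G_add: "G (v + w) = G v + G w" and G_sc: "G (sc c v) = sc c (G v)"
    and FF: "F (F v) = 0"
    and GGF: "G (G (F v)) = F (G (G v)) + F (G (F v))"
begin

lemma sc_0: "sc 0 v = 0"
  using sc_add_left[of 0 0 v] by simp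

abbreviation "free_action \<equiv> free_act sc F G"
abbreviation "act \<equiv> sj_act sc F G"
abbreviation "wact \<equiv> word_act F G"

lemma wact_add: "wact u (v + w) = wact u v + wact u w"
  by (induction u) (auto simp: F_add G_add split: sj_gen.split)

lemma wact_sc: "wact u (sc c v) = sc c (wact u v)"
  by (induction u) (auto simp: F_sc G_sc split: sj_gen.split)

lemma free_act_superset:
  assumes "finite S" "Poly_Mapping.keys p \<subseteq> S"
  shows "free_action p v = (\<Sum>w\<in>S. sc (Poly_Mapping.lookup p w) (case w of Free_Word u \<Rightarrow> wact u v))"
  unfolding free_act_def using assms
  by (intro sum.mono_neutral_left) (auto simp: in_keys_iff sc_0)

lemma free_act_add: "free_action (p + q) v = free_action p v + free_action q v"
proof -
  let ?S = "Poly_Mapping.keys p \<union> Poly_Mapping.keys q"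
  have "Poly_Mapping.keys (p + q) \<subseteq> ?S" by (rule Poly_Mapping.keys_add)
  then show ?thesis
    using free_act_superset[of ?S "p + q"] free_act_superset[of ?S p] free_act_superset[of ?S q]
    by (simp add: lookup_add sc_add_left sum.distrib)
qed

lemma free_act_single: "free_action (Poly_Mapping.single (Free_Word u) c) v = sc c (wact u v)"
  using free_act_superset[of "{Free_Word u}" "Poly_Mapping.single (Free_Word u) c" v]
  by (simp add: lookup_single)

lemma free_act_vadd: "free_action p (v + w) = free_action p v + free_action p w"
proof (induction p rule: poly_mapping_induct_add)
  case (single k c)
  show ?case by (cases k) (simp add: free_act_single wact_add sc_add_right)
qed (simp add: free_act_add algebra_simps)

lemma free_act_0: "free_action 0 v = 0"
  by (simp add: free_act_def)

lemma free_act_v0: "free_action p 0 = 0"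
  using free_act_vadd[of p 0 0] by simp

lemma free_act_mult: "free_action (p * q) v = free_action p (free_action q v)"
proof (induction p rule: poly_mapping_induct_add)
  case (single k c)
  show ?case
  proof (induction q rule: poly_mapping_induct_add)
    case (single l d)
    show ?case
      by (cases k; cases l) (simp add: mult_single free_act_single word_act_append wact_sc sc_mult)
  qed (simp add: distrib_left free_act_add free_act_vadd)
qed (simp add: distrib_right free_act_add)

lemma free_act_diff: "free_action (p - q) v = free_action p v - free_action q v"
  using free_act_add[of "p - q" q v] by simp

text \<open>The elements acting as zero form a two-sided ideal, and \<open>FF\<close> and
  \<open>GGF\<close> put both relators into it. This is what lets the action descend to the
  quotient.\<close>

lemma free_act_relation_ideal:
  assumes "p \<in> sj_relation_ideal"
  shows "free_action p v = 0"
proof -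
  let ?I = "{p. \<forall>v. free_action p v = 0}"
  have "ideal ?I ring_of_type_algebra"
    unfolding ideal_ring_of_type_algebra_iff
    by (auto simp: free_act_0 free_act_add free_act_mult free_act_v0)
  moreover have "{free_x ^ 2, free_y ^ 2 * free_x - free_x * free_y ^ 2 - free_x * free_y * free_x} \<subseteq> ?I"
    by (auto simp: power2_eq_square free_act_mult free_act_diff free_x_def free_y_def
        free_act_single sc_one FF GGF)
  ultimately have "sj_relation_ideal \<subseteq> ?I"
    unfolding sj_relation_ideal_def by (intro ring.genideal_minimal[OF ring_ring_of_type_algebra])
  with assms show ?thesis by blast
qed

lemma act_abs: "act (abs_super_jordan p) v = free_action p v"
proof -
  have "sj_cong (rep_super_jordan (abs_super_jordan p)) p"
    using Quotient_rep_abs[OF Quotient_super_jordan] equivp_reflp[OF equivp_sj_cong] by blast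
  then have "free_action (rep_super_jordan (abs_super_jordan p) - p) v = 0"
    unfolding sj_cong_def by (rule free_act_relation_ideal)
  then show ?thesis by (simp add: sj_act_def free_act_diff)
qed

lemma act_one: "act 1 v = v"
  using free_act_single[of Nil 1 v]
  by (simp add: one_super_jordan.abs_eq act_abs single_one sc_one flip: zero_free_word_def)

lemma act_x: "act sj_x v = F v"
  by (simp add: sj_x.abs_eq act_abs free_x_def free_act_single sc_one)

lemma act_y: "act sj_y v = G v"
  by (simp add: sj_y.abs_eq act_abs free_y_def free_act_single sc_one)

lemma act_const: "act (sj_const c) v = sc c v"
  by (simp add: sj_const.abs_eq act_abs zero_free_word_def free_act_single)

lemma act_add: "act (a + b) v = act a v + act b v"
  by (induct a rule: super_jordan.abs_induct; induct b rule: super_jordan.abs_induct)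
    (simp add: plus_super_jordan.abs_eq act_abs free_act_add)

lemma act_mult: "act (a * b) v = act a (act b v)"
  by (induct a rule: super_jordan.abs_induct; induct b rule: super_jordan.abs_induct)
    (simp add: times_super_jordan.abs_eq act_abs free_act_mult)

lemma act_vadd: "act a (v + w) = act a v + act a w"
  by (induct a rule: super_jordan.abs_induct) (simp add: act_abs free_act_vadd)

lemma act_0: "act 0 v = 0"
  using act_add[of 0 0 v] by simp

lemma act_v0: "act a 0 = 0"
  using act_vadd[of a 0 0] by simp

lemma act_diff: "act (a - b) v = act a v - act b v"
  using act_add[of "a - b" b v] by simp

end

section \<open>The subalgebra generated by \<open>s\<close> and \<open>y\<^sup>2\<close>\<close>

lemma sj_x_x: "sj_x * sj_x = (0 :: 'k :: field super_jordan)"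
  using sj_relations(1) by (simp add: power2_eq_square)

lemma sj_x_x_left: "sj_x * (sj_x * a) = (0 :: 'k :: field super_jordan)"
  using sj_x_x by (metis mult.assoc mult_zero_left)

lemma sj_y_y_x: "sj_y * sj_y * sj_x = sj_x * sj_y * sj_y + sj_x * sj_y * (sj_x :: 'k :: field super_jordan)"
proof -
  have "sj_y * sj_y * sj_x - sj_x * sj_y * sj_y - sj_x * sj_y * sj_x = (0 :: 'k super_jordan)"
    using sj_relations(2) by (simp add: power2_eq_square mult.assoc)
  then show ?thesis by (simp add: algebra_simps)
qed

lemma sj_x_s: "sj_x * sj_s = sj_x * sj_y * (sj_x :: 'k :: field super_jordan)"
  by (simp add: sj_s_def distrib_left sj_x_x_left mult.assoc)

lemma sj_s_x: "sj_s * sj_x = sj_x * (sj_s :: 'k :: field super_jordan)"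
  by (simp add: sj_s_def distrib_left distrib_right sj_x_x_left sj_x_x mult.assoc)

lemma sj_y_s: "sj_y * sj_s = sj_s * sj_y + sj_x * (sj_s :: 'k :: field super_jordan)"
proof -
  have "sj_y * sj_s = sj_y * sj_x * sj_y + sj_y * sj_y * (sj_x :: 'k super_jordan)"
    by (simp add: sj_s_def distrib_left mult.assoc)
  also have "\<dots> = (sj_y * sj_x + sj_x * sj_y) * sj_y + sj_x * sj_s"
    by (simp add: sj_y_y_x sj_x_s distrib_right add.assoc)
  finally show ?thesis by (simp add: sj_s_def add.commute)
qed

lemma sj_y_x: "sj_y * sj_x = sj_s - sj_x * (sj_y :: 'k :: field super_jordan)"
  by (simp add: sj_s_def)

definition sj_z :: "'k :: field super_jordan" where
  "sj_z = sj_y * sj_y"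

lemma sj_z_x: "sj_z * sj_x = sj_x * (sj_z + sj_s :: 'k :: field super_jordan)"
  using sj_y_y_x by (simp add: sj_z_def distrib_left sj_x_s mult.assoc)

text \<open>The defining relation of the Jordan plane; it makes the commutator with \<open>z\<close>
  act on polynomials in \<open>s\<close> as the derivation \<open>s^2 d/ds\<close>.\<close>

lemma sj_z_s: "sj_z * sj_s = sj_s * sj_z + sj_s * (sj_s :: 'k :: field super_jordan)"
proof -
  have "sj_z * sj_s = sj_y * (sj_s * sj_y + sj_x * (sj_s :: 'k super_jordan))"
    by (simp add: sj_z_def sj_y_s mult.assoc)
  also have "\<dots> = (sj_y * sj_s) * sj_y + sj_y * sj_x * sj_s"
    by (simp add: distrib_left mult.assoc)
  also have "\<dots> = sj_s * sj_z + sj_x * (sj_s * sj_y) + sj_y * sj_x * sj_s"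
    by (simp add: sj_y_s distrib_right sj_z_def mult.assoc)
  \<comment> \<open>The correction term of \<open>sj_y_s\<close> is \<open>x x s = 0\<close>, so the
    last two summands combine to \<open>(x y + y x) s = s s\<close>.\<close>
  also have "sj_x * (sj_s * sj_y) = sj_x * (sj_y * sj_s :: 'k super_jordan)"
    by (simp add: sj_y_s distrib_left sj_x_x_left)
  finally show ?thesis by (simp add: sj_s_def distrib_right mult.assoc add.assoc)
qed

section \<open>Polynomials in one element\<close>

text \<open>Horner evaluation at an element of a noncommutative algebra. Constants are central, so
  it is a ring homomorphism for each \<open>t\<close>; it serves with \<open>t = s\<close> for
  coefficients and with \<open>t = y\<close> for the quotient by \<open>x\<close>.\<close>

definition sj_poly :: "'k :: field super_jordan \<Rightarrow> 'k poly \<Rightarrow> 'k super_jordan" where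
  "sj_poly t f = fold_coeffs (\<lambda>c b. sj_const c + t * b) f 0"

lemma sj_poly_0 [simp]: "sj_poly t 0 = 0"
  by (simp add: sj_poly_def)

lemma sj_poly_pCons: "sj_poly t (pCons c f) = sj_const c + t * sj_poly t f"
  by (cases "c = 0 \<and> f = 0") (auto simp: sj_poly_def sj_const_0)

lemma sj_poly_1 [simp]: "sj_poly t 1 = 1"
  by (simp add: one_pCons sj_poly_pCons sj_const_1)

lemma sj_poly_add: "sj_poly t (f + g) = sj_poly t f + sj_poly t g"
proof (induction f g rule: poly_induct2)
  case (pCons c f d g)
  then show ?case by (simp add: sj_poly_pCons sj_const_add algebra_simps)
qed simp

lemma sj_poly_minus: "sj_poly t (- f) = - sj_poly t f"
  using sj_poly_add[of t f "- f"] by (simp add: eq_neg_iff_add_eq_0 add.commute)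

lemma sj_poly_diff: "sj_poly t (f - g) = sj_poly t f - sj_poly t g"
  using sj_poly_add[of t f "- g"] by (simp add: sj_poly_minus)

lemma sj_poly_smult: "sj_poly t (smult c f) = sj_const c * sj_poly t f"
proof (induction f)
  case (pCons d f)
  have "t * (sj_const c * sj_poly t f) = sj_const c * (t * sj_poly t f)"
    by (metis mult.assoc sj_const_commute)
  with pCons show ?case
    by (simp add: sj_poly_pCons sj_const_mult distrib_left)
qed simp

lemma sj_poly_mult: "sj_poly t (f * g) = sj_poly t f * sj_poly t g"
proof (induction f)
  case (pCons c f)
  have "sj_poly t (pCons c f * g) = sj_poly t (smult c g) + sj_poly t (pCons 0 (f * g))"
    by (simp add: sj_poly_add)
  also have "\<dots> = sj_const c * sj_poly t g + t * sj_poly t f * sj_poly t g"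
    by (simp add: sj_poly_smult sj_poly_pCons sj_const_0 pCons mult.assoc)
  finally show ?case by (simp add: sj_poly_pCons distrib_right)
qed simp

lemma sj_poly_commute: "sj_poly t f * sj_poly t g = sj_poly t g * sj_poly t f"
  by (metis mult.commute sj_poly_mult)

lemma sj_poly_const: "sj_poly t [:c:] = sj_const c"
  by (simp add: sj_poly_pCons)

lemma sj_poly_monom: "sj_poly t (monom c n) = sj_const c * t ^ n"
proof (induction n)
  case (Suc n)
  have "t * (sj_const c * t ^ n) = sj_const c * (t * t ^ n)"
    by (metis mult.assoc sj_const_commute)
  with Suc show ?case by (simp add: monom_Suc sj_poly_pCons sj_const_0)
qed (simp add: monom_0 sj_poly_pCons)

abbreviation s_poly :: "'k :: field poly \<Rightarrow> 'k super_jordan" where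
  "s_poly \<equiv> sj_poly sj_s"

lemma s_poly_u: "s_poly [:0, 1:] = sj_s"
  by (simp add: sj_poly_pCons sj_const_0 sj_const_1)

lemma s_poly_uu: "s_poly [:0, 0, 1:] = sj_s * sj_s"
  by (simp add: sj_poly_pCons sj_const_0 sj_const_1)

lemma sj_x_s_poly: "sj_x * s_poly f = s_poly f * sj_x"
proof (induction f)
  case (pCons c f)
  have "sj_x * (sj_s * s_poly f) = sj_s * (sj_x * s_poly f)"
    by (metis mult.assoc sj_s_x)
  with pCons show ?case
    by (simp add: sj_poly_pCons distrib_left distrib_right sj_const_commute mult.assoc)
qed simp

lemma sj_s_s_poly: "sj_s * s_poly f = s_poly ([:0, 1:] * f)"
  by (simp add: sj_poly_pCons sj_const_0)

text \<open>The commutator with \<open>z\<close> is a derivation sending \<open>s\<close> to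
  \<open>s^2\<close>, hence \<open>f(s)\<close> to \<open>s^2 f'(s)\<close>;
  \<open>[:0, 0, 1:]\<close> is the square of the variable.\<close>

lemma sj_z_s_poly: "sj_z * s_poly f = s_poly f * sj_z + s_poly ([:0, 0, 1:] * pderiv f)"
proof (induction f)
  case (pCons c f)
  have "sj_z * s_poly (pCons c f) = sj_const c * sj_z + sj_z * sj_s * s_poly f"
    by (simp add: sj_poly_pCons distrib_left sj_const_commute mult.assoc)
  also have "sj_z * sj_s * s_poly f = sj_s * (sj_z * s_poly f) + sj_s * sj_s * s_poly f"
    by (simp add: sj_z_s distrib_right mult.assoc)
  also have "\<dots> = sj_s * s_poly f * sj_z + (sj_s * s_poly ([:0, 0, 1:] * pderiv f) + sj_s * sj_s * s_poly f)"
    unfolding pCons by (simp add: distrib_left mult.assoc)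
  also have "sj_s * s_poly ([:0, 0, 1:] * pderiv f) + sj_s * sj_s * s_poly f =
      s_poly ([:0, 0, 1:] * pderiv (pCons c f))"
    unfolding sj_s_s_poly s_poly_uu[symmetric] sj_poly_mult[symmetric] sj_poly_add[symmetric]
    by (rule arg_cong[of _ _ s_poly]) (simp add: pderiv_pCons algebra_simps)
  finally show ?case by (simp add: sj_poly_pCons distrib_right add.assoc)
qed simp

section \<open>The filtration by degree in \<open>z\<close>\<close>

text \<open>Sums of \<open>f(s) z^i\<close> with \<open>i < n\<close>. The index counts terms:
  \<open>sz_filtration 0\<close> is \<open>{0}\<close>, and \<open>sz_filtration n\<close> holds
  exactly the lower-order remainders next to a term in \<open>z^n\<close>.\<close>

primrec sz_filtration :: "nat \<Rightarrow> 'k :: field super_jordan set" where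
  "sz_filtration 0 = {0}"
| "sz_filtration (Suc n) = {s_poly f * sj_z ^ n + b | f b. b \<in> sz_filtration n}"

lemma sz_filtration_0: "0 \<in> sz_filtration n"
proof (induction n)
  case (Suc n)
  then show ?case by (auto intro!: exI[of _ 0])
qed simp

lemma sz_filtration_term: "s_poly f * sj_z ^ n \<in> sz_filtration (Suc n)"
  unfolding sz_filtration.simps using sz_filtration_0[of n] by (metis (mono_tags, lifting) add.right_neutral mem_Collect_eq)

lemma sz_filtration_SucI: "b \<in> sz_filtration n \<Longrightarrow> b \<in> sz_filtration (Suc n)"
  by (force intro!: exI[of _ 0] exI[of _ b])

lemma sz_filtration_mono:
  assumes "m \<le> n" "b \<in> sz_filtration m"
  shows "b \<in> sz_filtration n"
  using assms by (induction rule: dec_induct) (auto intro: sz_filtration_SucI simp del: sz_filtration.simps)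

lemma sz_filtration_add:
  "b \<in> sz_filtration n \<Longrightarrow> c \<in> sz_filtration n \<Longrightarrow> b + c \<in> sz_filtration n"
proof (induction n arbitrary: b c)
  case (Suc n)
  then obtain f b' g c' where "b = s_poly f * sj_z ^ n + b'" "b' \<in> sz_filtration n"
    "c = s_poly g * sj_z ^ n + c'" "c' \<in> sz_filtration n" by auto
  with Suc.IH[of b' c'] show ?case
    by (auto simp: sj_poly_add distrib_right algebra_simps intro!: exI[of _ "f + g"] exI[of _ "b' + c'"])
qed simp

lemma sz_filtration_s_poly_mult: "b \<in> sz_filtration n \<Longrightarrow> s_poly f * b \<in> sz_filtration n"
proof (induction n arbitrary: b)
  case (Suc n)
  then obtain g b' where "b = s_poly g * sj_z ^ n + b'" "b' \<in> sz_filtration n" by auto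
  with Suc.IH[of b'] show ?case
    by (auto simp: sj_poly_mult distrib_left mult.assoc intro!: exI[of _ "f * g"] exI[of _ "s_poly f * b'"])
qed simp

lemma sz_filtration_s_mult: "b \<in> sz_filtration n \<Longrightarrow> sj_s * b \<in> sz_filtration n"
  using sz_filtration_s_poly_mult[of b n "[:0, 1:]"] by (simp add: s_poly_u)

lemma sz_filtration_uminus: "b \<in> sz_filtration n \<Longrightarrow> - b \<in> sz_filtration n"
  using sz_filtration_s_poly_mult[of b n "- 1"] by (simp add: sj_poly_minus)

lemma sz_filtration_diff:
  "b \<in> sz_filtration n \<Longrightarrow> c \<in> sz_filtration n \<Longrightarrow> b - c \<in> sz_filtration n"
  using sz_filtration_add[of b n "- c"] sz_filtration_uminus[of c n] by simp

lemma sz_filtration_z_mult: "b \<in> sz_filtration n \<Longrightarrow> sj_z * b \<in> sz_filtration (Suc n)"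
proof (induction n arbitrary: b)
  case (Suc n)
  then obtain g b' where b: "b = s_poly g * sj_z ^ n + b'" "b' \<in> sz_filtration n" by auto
  let ?c = "s_poly ([:0, 0, 1:] * pderiv g) * sj_z ^ n + sj_z * b'"
  have "sj_z * b = (sj_z * s_poly g) * sj_z ^ n + sj_z * b'"
    by (simp add: b distrib_left mult.assoc)
  also have "\<dots> = s_poly g * sj_z ^ Suc n + ?c"
    unfolding sj_z_s_poly by (simp add: distrib_right mult.assoc del: mult_pCons_left)
  finally have "sj_z * b = s_poly g * sj_z ^ Suc n + ?c" .
  moreover have "?c \<in> sz_filtration (Suc n)"
    using sz_filtration_term Suc.IH[OF b(2)] by (rule sz_filtration_add)
  ultimately show ?case unfolding sz_filtration.simps(2)[of "Suc n"] by blast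
qed (use sz_filtration_0[of "Suc 0"] in \<open>simp del: sz_filtration.simps(2)\<close>)

text \<open>Each of the \<open>Suc n\<close> factors \<open>z\<close> contributes one
  \<open>s^2\<close> when \<open>s\<close> passes it; reordering affects only lower degrees.\<close>

lemma sj_z_power_s:
  "\<exists>b\<in>sz_filtration n :: 'k :: field super_jordan set. sj_z ^ Suc n * sj_s =
     sj_s * sj_z ^ Suc n + s_poly (smult (of_nat (Suc n)) [:0, 0, 1:]) * sj_z ^ n + b"
proof (induction n)
  case 0
  show ?case by (simp add: sj_z_s s_poly_uu)
next
  case (Suc n)
  then obtain b :: "'k super_jordan" where b: "b \<in> sz_filtration n" and eq: "sj_z ^ Suc n * sj_s =
     sj_s * sj_z ^ Suc n + s_poly (smult (of_nat (Suc n)) [:0, 0, 1:]) * sj_z ^ n + b" by blast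
  let ?g = "smult (of_nat (Suc n)) [:0, 0, 1:] :: 'k poly"
  let ?c = "s_poly ([:0, 0, 1:] * pderiv ?g) * sj_z ^ n + sj_z * b"
  have "sj_z ^ Suc (Suc n) * sj_s = sj_z * (sj_z ^ Suc n * sj_s)"
    by (simp add: mult.assoc)
  also have "\<dots> = (sj_z * sj_s) * sj_z ^ Suc n + (sj_z * s_poly ?g) * sj_z ^ n + sj_z * b"
    unfolding eq by (simp only: distrib_left mult.assoc)
  also have "\<dots> = sj_s * sj_z ^ Suc (Suc n) + (s_poly [:0, 0, 1:] + s_poly ?g) * sj_z ^ Suc n + ?c"
    unfolding sj_z_s sj_z_s_poly s_poly_uu
    by (simp only: distrib_right mult.assoc power_Suc add_ac)
  also have "s_poly [:0, 0, 1:] + s_poly ?g = s_poly (smult (of_nat (Suc (Suc n))) [:0, 0, 1:])"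
    unfolding sj_poly_add[symmetric] by (rule arg_cong[of _ _ s_poly]) simp
  finally have "sj_z ^ Suc (Suc n) * sj_s = sj_s * sj_z ^ Suc (Suc n) +
      s_poly (smult (of_nat (Suc (Suc n))) [:0, 0, 1:]) * sj_z ^ Suc n + ?c" .
  moreover have "?c \<in> sz_filtration (Suc n)"
    using sz_filtration_term sz_filtration_z_mult[OF b] by (rule sz_filtration_add)
  ultimately show ?case by blast
qed

text \<open>Coefficients commute with \<open>s\<close>, so only the power of \<open>z\<close>
  contributes. The degree drops by one and the new leading coefficient \<open>(n + 1) s^2 f\<close>
  stays nonzero in characteristic zero.\<close>

lemma commutator_s_leading:
  fixes b :: "'k :: field super_jordan"
  assumes "b \<in> sz_filtration (Suc n)"
  shows "\<exists>c\<in>sz_filtration n.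
    (s_poly f * sj_z ^ Suc n + b) * sj_s - sj_s * (s_poly f * sj_z ^ Suc n + b) =
      s_poly (smult (of_nat (Suc n)) [:0, 0, 1:] * f) * sj_z ^ n + c"
proof -
  \<comment> \<open>\<open>lead\<close> takes the bound on the commutator of the lower part as a
    premise; \<open>comm\<close> proves that bound by induction, with \<open>lead\<close> in each
    step.\<close>
  have lead: "\<exists>c\<in>sz_filtration n.
        (s_poly f * sj_z ^ Suc n + b) * sj_s - sj_s * (s_poly f * sj_z ^ Suc n + b) =
           s_poly (smult (of_nat (Suc n)) [:0, 0, 1:] * f) * sj_z ^ n + c"
    if b: "b * sj_s - sj_s * b \<in> sz_filtration n" for b :: "'k super_jordan" and f n
  proof -
    obtain c :: "'k super_jordan" where c: "c \<in> sz_filtration n" and eq: "sj_z ^ Suc n * sj_s =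
       sj_s * sj_z ^ Suc n + s_poly (smult (of_nat (Suc n)) [:0, 0, 1:]) * sj_z ^ n + c"
      using sj_z_power_s by blast
    have "(s_poly f * sj_z ^ Suc n + b) * sj_s - sj_s * (s_poly f * sj_z ^ Suc n + b) =
        s_poly f * (sj_z ^ Suc n * sj_s) - (sj_s * s_poly f) * sj_z ^ Suc n + (b * sj_s - sj_s * b)"
      by (simp only: algebra_simps)
    also have "\<dots> = (s_poly f * s_poly [:0, 1:] - s_poly [:0, 1:] * s_poly f) * sj_z ^ Suc n +
        s_poly (smult (of_nat (Suc n)) [:0, 0, 1:] * f) * sj_z ^ n + (s_poly f * c + (b * sj_s - sj_s * b))"
      unfolding eq s_poly_u sj_poly_mult sj_poly_commute[of _ "smult _ _" f]
      by (simp only: algebra_simps)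
    finally have "(s_poly f * sj_z ^ Suc n + b) * sj_s - sj_s * (s_poly f * sj_z ^ Suc n + b) =
        s_poly (smult (of_nat (Suc n)) [:0, 0, 1:] * f) * sj_z ^ n + (s_poly f * c + (b * sj_s - sj_s * b))"
      by (simp only: sj_poly_commute[of _ "[:0, 1:]" f] diff_self mult_zero_left add_0_left)
    then show ?thesis
      using sz_filtration_add[OF sz_filtration_s_poly_mult[OF c] b] by blast
  qed
  have comm: "b \<in> sz_filtration (Suc n) \<Longrightarrow> b * sj_s - sj_s * b \<in> sz_filtration n" for b :: "'k super_jordan" and n
  proof (induction n arbitrary: b)
    case 0
    then obtain f where "b = s_poly f" by auto
    then show ?case using sj_poly_commute[of sj_s f "[:0, 1:]"] by (simp only: s_poly_u) simp
  next
    case (Suc n)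
    then obtain f b' where b: "b = s_poly f * sj_z ^ Suc n + b'" "b' \<in> sz_filtration (Suc n)"
      unfolding sz_filtration.simps(2)[of "Suc n"] by blast
    from lead[OF Suc.IH[OF b(2)], of f]
    obtain c where c: "c \<in> sz_filtration n" "b * sj_s - sj_s * b =
        s_poly (smult (of_nat (Suc n)) [:0, 0, 1:] * f) * sj_z ^ n + c"
      unfolding b(1) by blast
    then show ?case unfolding sz_filtration.simps(2) by blast
  qed
  show ?thesis
    using lead[OF comm[OF assms]] .
qed

text \<open>From \<open>z x = x (z + s)\<close> follows \<open>z^n x = x (z + s)^n\<close>, and the
  leading term of \<open>(z + s)^n\<close> is \<open>z^n\<close>.\<close>

lemma sj_z_power_x: "\<exists>b\<in>sz_filtration n :: 'k :: field super_jordan set. sj_z ^ n * sj_x = sj_x * (sj_z ^ n + b)"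
proof (induction n)
  case (Suc n)
  then obtain b :: "'k super_jordan" where b: "b \<in> sz_filtration n" "sj_z ^ n * sj_x = sj_x * (sj_z ^ n + b)" by blast
  let ?c = "sj_s * sj_z ^ n + (sj_z * b + sj_s * b)"
  have "sj_z ^ Suc n * sj_x = (sj_z * sj_x) * (sj_z ^ n + b)"
    by (simp add: b(2) mult.assoc)
  also have "\<dots> = sj_x * (sj_z ^ Suc n + ?c)"
    unfolding sj_z_x by (simp add: algebra_simps)
  finally have "sj_z ^ Suc n * sj_x = sj_x * (sj_z ^ Suc n + ?c)" .
  moreover have "?c \<in> sz_filtration (Suc n)"
    using sz_filtration_term[of "[:0, 1:]" n] sz_filtration_z_mult[OF b(1)]
      sz_filtration_SucI[OF sz_filtration_s_mult[OF b(1)]]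
    unfolding s_poly_u by (intro sz_filtration_add)
  ultimately show ?case by blast
qed simp

text \<open>The inclusion of \<open>B x\<close> in \<open>x B\<close>, with the leading coefficient
  tracked: \<open>f(s)\<close> commutes with \<open>x\<close>, and \<open>z^n\<close> passes it up
  to lower-order corrections.\<close>

lemma
  fixes b :: "'k :: field super_jordan"
  shows sz_filtration_mult_x: "b \<in> sz_filtration n \<Longrightarrow> \<exists>c\<in>sz_filtration n. b * sj_x = sj_x * c"
    and mult_x_leading: "b \<in> sz_filtration n \<Longrightarrow>
      \<exists>c\<in>sz_filtration n. (s_poly f * sj_z ^ n + b) * sj_x = sj_x * (s_poly f * sj_z ^ n + c)"
proof -
  have lead: "\<exists>c\<in>sz_filtration n. (s_poly f * sj_z ^ n + b) * sj_x = sj_x * (s_poly f * sj_z ^ n + c)"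
    if b: "\<exists>c\<in>sz_filtration n. b * sj_x = sj_x * c" for b :: "'k super_jordan" and f n
  proof -
    obtain c where c: "c \<in> sz_filtration n" "b * sj_x = sj_x * c" using b by blast
    obtain d :: "'k super_jordan" where d: "d \<in> sz_filtration n" "sj_z ^ n * sj_x = sj_x * (sj_z ^ n + d)"
      using sj_z_power_x by blast
    have "(s_poly f * sj_z ^ n + b) * sj_x = s_poly f * (sj_z ^ n * sj_x) + b * sj_x"
      by (simp only: distrib_right mult.assoc)
    also have "\<dots> = (sj_x * s_poly f) * (sj_z ^ n + d) + sj_x * c"
      unfolding c d sj_x_s_poly by (simp only: mult.assoc)
    also have "\<dots> = sj_x * (s_poly f * sj_z ^ n + (s_poly f * d + c))"
      by (simp only: distrib_left mult.assoc add.assoc)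
    finally show ?thesis
      using sz_filtration_add[OF sz_filtration_s_poly_mult[OF d(1)] c(1)] by blast
  qed
  show all: "b \<in> sz_filtration n \<Longrightarrow> \<exists>c\<in>sz_filtration n. b * sj_x = sj_x * c" for b :: "'k super_jordan" and n
  proof (induction n arbitrary: b)
    case (Suc n)
    then obtain f b' where b: "b = s_poly f * sj_z ^ n + b'" "b' \<in> sz_filtration n" by auto
    from lead[OF Suc.IH[OF b(2)], of f] obtain c where
      "c \<in> sz_filtration n" "b * sj_x = sj_x * (s_poly f * sj_z ^ n + c)"
      unfolding b(1) by blast
    then show ?case unfolding sz_filtration.simps(2) by blast
  qed simp
  show "b \<in> sz_filtration n \<Longrightarrow>
      \<exists>c\<in>sz_filtration n. (s_poly f * sj_z ^ n + b) * sj_x = sj_x * (s_poly f * sj_z ^ n + c)"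
    using lead all by blast
qed

text \<open>Zero top coefficients are stripped until a nonzero one appears. Only existence is
  claimed, not uniqueness of \<open>m\<close> and \<open>f\<close>.\<close>

lemma sz_filtration_leading:
  assumes "b \<in> sz_filtration n" "b \<noteq> 0"
  obtains m f c where "f \<noteq> 0" "c \<in> sz_filtration m" "b = s_poly f * sj_z ^ m + c"
  using assms
proof (induction n arbitrary: b thesis)
  case (Suc n)
  then obtain f c where b: "b = s_poly f * sj_z ^ n + c" "c \<in> sz_filtration n" by auto
  show ?case
  proof (cases "f = 0")
    case True
    with b Suc.prems(3) have "c \<noteq> 0" "b = c" by auto
    with Suc.IH[of c] b(2) Suc.prems(1) show ?thesis by blast
  qed (use b Suc.prems(1) in blast)
qed simp

section \<open>Nonzero ideals contain a power of \<open>s\<close>\<close>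

text \<open>The commutator of \<open>z\<close> with \<open>x f(s)\<close>: the derivation gives
  \<open>s^2 f'\<close>, and moving \<open>z\<close> past \<open>x\<close> adds
  \<open>s f\<close>.\<close>

lemma x_s_poly_ideal_step:
  assumes I: "ideal I (ring_of_type_algebra :: 'k :: field super_jordan ring)"
    and f: "sj_x * s_poly f \<in> I"
  shows "sj_x * s_poly ([:0, 0, 1:] * pderiv f + [:0, 1:] * f) \<in> I"
proof -
  have "sj_z * (sj_x * s_poly f) - sj_x * s_poly f * sj_z \<in> I"
    using ideal_diff[OF I ideal_mult_left[OF I f] ideal_mult_right[OF I f]] .
  also have "sj_z * (sj_x * s_poly f) = (sj_z * sj_x) * s_poly f"
    by (simp only: mult.assoc)
  also have "\<dots> = sj_x * (sj_z * s_poly f) + sj_x * (sj_s * s_poly f)"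
    unfolding sj_z_x by (simp only: algebra_simps)
  also have "\<dots> = sj_x * s_poly f * sj_z +
      sj_x * s_poly ([:0, 0, 1:] * pderiv f + [:0, 1:] * f)"
    unfolding sj_z_s_poly sj_s_s_poly sj_poly_add by (simp only: algebra_simps)
  finally show ?thesis by (simp only: add_diff_cancel_left')
qed

lemma x_s_power_imp_s_power:
  assumes I: "ideal I (ring_of_type_algebra :: 'k :: field super_jordan ring)"
    and f: "sj_x * sj_s ^ n \<in> I"
  shows "sj_s ^ Suc n \<in> I"
proof -
  \<comment> \<open>As \<open>x x = 0\<close>, the relation for \<open>y s\<close> makes
    \<open>s\<close> commute with \<open>x y\<close>; so \<open>x s^n y = x y s^n\<close>, and
    adding \<open>y x s^n\<close> yields \<open>s^(n+1)\<close>.\<close>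
  have "sj_x * sj_y * sj_s = sj_s * (sj_x * sj_y :: 'k super_jordan)"
    by (simp add: mult.assoc sj_y_s distrib_left sj_x_x_left)
      (metis mult.assoc sj_s_x)
  then have "sj_x * sj_y * sj_s ^ n = sj_s ^ n * (sj_x * sj_y :: 'k super_jordan)"
    by (metis power_commuting_commutes)
  moreover have "sj_s ^ n * sj_x = sj_x * (sj_s ^ n :: 'k super_jordan)"
    by (metis power_commuting_commutes sj_s_x)
  ultimately have "sj_x * sj_s ^ n * sj_y = sj_x * sj_y * (sj_s ^ n :: 'k super_jordan)"
    by (metis mult.assoc)
  moreover have "sj_x * sj_s ^ n * sj_y + sj_y * (sj_x * sj_s ^ n) \<in> I"
    using ideal_add[OF I ideal_mult_right[OF I f] ideal_mult_left[OF I f]] .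
  ultimately show ?thesis
    by (simp add: sj_s_def distrib_right mult.assoc)
qed

text \<open>
  Commuting \<open>x s\<^sup>n f(s)\<close> with \<open>y\<^sup>2\<close> and subtracting a multiple of it by \<open>s\<close> removes the leading
  coefficient of \<open>f\<close>, unless \<open>f\<close> is a monomial.
\<close>

lemma x_s_poly_imp_s_power:
  fixes f :: "'k :: {field, ring_char_0} poly"
  assumes I: "ideal I (ring_of_type_algebra :: 'k super_jordan ring)"
    and "sj_x * s_poly (monom 1 n * f) \<in> I" "f \<noteq> 0" "degree f \<le> m"
  shows "\<exists>k. sj_s ^ k \<in> I"
  using assms(2-)
proof (induction m arbitrary: f n)
  case 0
  then obtain c where c: "f = [:c:]" "c \<noteq> 0" by (auto elim: degree_eq_zeroE)
  have "sj_x * s_poly (monom 1 n * f) * sj_const (inverse c) \<in> I"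
    using ideal_mult_right[OF I 0(1)] .
  also have "s_poly (monom 1 n * f) = sj_s ^ n * sj_const c"
    by (simp only: sj_poly_mult sj_poly_monom c sj_poly_const sj_const_1 mult_1_left)
  finally have "sj_x * sj_s ^ n \<in> I"
    using c(2) by (simp add: mult.assoc sj_const_1 flip: sj_const_mult)
  then show ?case using x_s_power_imp_s_power[OF I] by blast
next
  case (Suc m)
  \<comment> \<open>The Euler operator minus \<open>Suc m\<close> multiplies the coefficient of
    degree \<open>i\<close> by \<open>i - Suc m\<close>. It kills degree \<open>Suc m\<close> and,
    in characteristic zero, no other, so \<open>g = 0\<close> forces \<open>f\<close> to be a
    monomial.\<close>
  define g where "g = [:0, 1:] * pderiv f - smult (of_nat (Suc m)) f"
  have coeff_g: "coeff g i = (of_nat i - of_nat (Suc m)) * coeff f i" for i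
    by (cases i) (simp_all add: g_def coeff_pderiv algebra_simps)
  let ?h = "monom 1 n * f"
  have two: "p * 2 = smult 2 p" "p * (2 * q) = smult 2 (p * q)" for p q :: "'k poly"
    by (simp_all add: numeral_poly)
  \<comment> \<open>The commutator turns \<open>s^n f\<close> into
    \<open>s^(n+1) (s f' + (n+1) f)\<close>; subtracting \<open>Suc m + Suc n\<close> times
    \<open>s^(n+1) f\<close> leaves \<open>s^(n+1) g\<close>. Keeping the power of \<open>s\<close>
    as a separate factor lets the degree bound on \<open>f\<close> decrease.\<close>
  have "[:0, 0, 1:] * pderiv ?h + [:0, 1:] * ?h - smult (of_nat (Suc m + Suc n)) ([:0, 1:] * ?h) =
      monom 1 (Suc n) * g"
  proof (cases n)
    case 0
    then show ?thesis
      by (simp add: g_def monom_Suc monom_0 two algebra_simps smult_add_left smult_diff_right smult_add_right)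
  next
    case (Suc n')
    have "[:0, 0, 1:] * pderiv (monom 1 n) = smult (of_nat n) ([:0, 1:] * monom 1 n :: 'k poly)"
      unfolding Suc pderiv_monom by (simp add: monom_Suc smult_monom)
    then show ?thesis
      by (simp add: g_def monom_Suc pderiv_mult two algebra_simps smult_add_left smult_diff_right smult_add_right)
  qed
  moreover have "sj_x * s_poly ([:0, 0, 1:] * pderiv ?h + [:0, 1:] * ?h) -
      (sj_x * s_poly ?h) * s_poly (smult (of_nat (Suc m + Suc n)) [:0, 1:]) \<in> I"
    by (rule ideal_diff[OF I x_s_poly_ideal_step[OF I Suc.prems(1)] ideal_mult_right[OF I Suc.prems(1)]])
  then have "sj_x * s_poly ([:0, 0, 1:] * pderiv ?h + [:0, 1:] * ?h -
      smult (of_nat (Suc m + Suc n)) ([:0, 1:] * ?h)) \<in> I"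
    unfolding sj_poly_diff mult_smult_left[symmetric] mult.commute[of "smult _ _" ?h]
    unfolding sj_poly_mult right_diff_distrib mult.assoc .
  ultimately have gI: "sj_x * s_poly (monom 1 (Suc n) * g) \<in> I" by simp
  show ?case
  proof (cases "g = 0")
    case False
    have "degree g \<le> m"
      using Suc.prems(3) coeff_g
      by (intro degree_le) (metis Suc_lessI coeff_eq_0 le_less_trans mult_zero_left mult_zero_right diff_self)
    then show ?thesis using Suc.IH[OF gI False] by blast
  next
    case True
    have "f = monom (coeff f (Suc m)) (Suc m)"
    proof (rule poly_eqI)
      fix i
      have "(of_nat i - of_nat (Suc m)) * coeff f i = (0 :: 'k)" using coeff_g[of i] True by simp
      then have "i = Suc m \<or> coeff f i = 0"
        by (metis eq_iff_diff_eq_0 mult_eq_0_iff of_nat_eq_iff)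
      then show "coeff f i = coeff (monom (coeff f (Suc m)) (Suc m)) i" by auto
    qed
    then obtain c where c: "f = monom c (Suc m)" "c \<noteq> 0" using Suc.prems(2) by (metis monom_0 monom_eq_0)
    have "sj_x * s_poly (monom 1 n * f) * sj_const (inverse c) \<in> I"
      using ideal_mult_right[OF I Suc.prems(1)] .
    also have "s_poly (monom 1 n * f) = sj_s ^ (n + Suc m) * sj_const c"
      by (simp only: c mult_monom sj_poly_monom mult_1_left sj_const_commute)
    finally have "sj_x * sj_s ^ (n + Suc m) \<in> I"
      using c(2) by (simp add: mult.assoc sj_const_1 flip: sj_const_mult)
    then show ?thesis using x_s_power_imp_s_power[OF I] by blast
  qed
qed

text \<open>\<open>s\<close> commutes with \<open>x\<close>, so the commutator with \<open>s\<close>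
  acts on the second factor only. It lowers \<open>n\<close> and replaces \<open>f\<close> by a
  nonzero multiple of \<open>s^2 f\<close>.\<close>

lemma x_leading_imp_s_power:
  fixes f :: "'k :: {field, ring_char_0} poly"
  assumes I: "ideal I (ring_of_type_algebra :: 'k super_jordan ring)"
    and "sj_x * (s_poly f * sj_z ^ n + b) \<in> I" "f \<noteq> 0" "b \<in> sz_filtration n"
  shows "\<exists>k. sj_s ^ k \<in> I"
  using assms(2-)
proof (induction n arbitrary: f b)
  case 0
  \<comment> \<open>Here \<open>b = 0\<close>, because \<open>sz_filtration 0\<close> is
    \<open>{0}\<close>.\<close>
  then show ?case using x_s_poly_imp_s_power[OF I, of 0 f "degree f"] by (simp add: monom_0)
next
  case (Suc n)
  let ?b = "s_poly f * sj_z ^ Suc n + b"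
  from commutator_s_leading[OF Suc.prems(3), of f] obtain c where c: "c \<in> sz_filtration n"
    "?b * sj_s - sj_s * ?b = s_poly (smult (of_nat (Suc n)) [:0, 0, 1:] * f) * sj_z ^ n + c" by blast
  have "(sj_x * ?b) * sj_s - sj_s * (sj_x * ?b) \<in> I"
    using ideal_diff[OF I ideal_mult_right[OF I Suc.prems(1)] ideal_mult_left[OF I Suc.prems(1)]] .
  also have "sj_s * (sj_x * ?b) = sj_x * (sj_s * ?b)"
    by (metis mult.assoc sj_s_x)
  finally have "sj_x * (?b * sj_s - sj_s * ?b) \<in> I"
    by (simp only: right_diff_distrib mult.assoc)
  then show ?case
    unfolding c(2) by (rule Suc.IH[OF _ _ c(1)]) (use Suc.prems(2) in \<open>simp del: of_nat_Suc\<close>)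
qed

lemma x_sz_imp_s_power:
  fixes b :: "'k :: {field, ring_char_0} super_jordan"
  assumes I: "ideal I (ring_of_type_algebra :: 'k super_jordan ring)"
    and "sj_x * b \<in> I" "b \<in> sz_filtration n" "b \<noteq> 0"
  shows "\<exists>k. sj_s ^ k \<in> I"
  using sz_filtration_leading[OF assms(3,4)] x_leading_imp_s_power[OF I] assms(2) by metis

text \<open>Moving the right-hand \<open>x\<close> through \<open>b\<close> produces
  \<open>x y x = x s\<close>, so the leading coefficient becomes \<open>s f\<close>, still nonzero.
  This detects components that carry a factor \<open>x y\<close>.\<close>

lemma x_y_sz_x_imp_s_power:
  fixes b :: "'k :: {field, ring_char_0} super_jordan"
  assumes I: "ideal I (ring_of_type_algebra :: 'k super_jordan ring)"
    and bI: "sj_x * sj_y * b * sj_x \<in> I" and "b \<in> sz_filtration n" "b \<noteq> 0"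
  shows "\<exists>k. sj_s ^ k \<in> I"
proof -
  obtain m f c where f: "f \<noteq> 0" and c: "c \<in> sz_filtration m" and b: "b = s_poly f * sj_z ^ m + c"
    using sz_filtration_leading[OF assms(3,4)] .
  from mult_x_leading[OF c, of f] obtain d where d: "d \<in> sz_filtration m"
    "b * sj_x = sj_x * (s_poly f * sj_z ^ m + d)" unfolding b by blast
  have "sj_x * sj_y * b * sj_x = (sj_x * sj_y * sj_x) * (s_poly f * sj_z ^ m + d)"
    by (simp only: mult.assoc d(2))
  also have "\<dots> = sj_x * (s_poly ([:0, 1:] * f) * sj_z ^ m + sj_s * d)"
    unfolding sj_x_s[symmetric] sj_s_s_poly[symmetric] by (simp only: mult.assoc distrib_left)
  finally have "sj_x * (s_poly ([:0, 1:] * f) * sj_z ^ m + sj_s * d) \<in> I" using bI by simp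
  then show ?thesis
    by (rule x_leading_imp_s_power[OF I _ _ sz_filtration_s_mult[OF d(1)]]) (use f in simp)
qed

text \<open>The right \<open>B\<close>-span of \<open>1\<close>, \<open>x\<close>, \<open>y\<close>,
  \<open>x y\<close> contains 1 and is stable under left multiplication by the generators. The index
  grows by one under \<open>y\<close>, since \<open>y y = z\<close>.\<close>

lemma super_jordan_decomposition:
  fixes a :: "'k :: field super_jordan"
  shows "\<exists>n. \<exists>b1\<in>sz_filtration n. \<exists>b2\<in>sz_filtration n. \<exists>b3\<in>sz_filtration n. \<exists>b4\<in>sz_filtration n.
    a = b1 + sj_x * b2 + sj_y * b3 + sj_x * sj_y * b4"
proof (induction a rule: super_jordan_induct)
  case one
  have "(1 :: 'k super_jordan) \<in> sz_filtration 1"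
    using sz_filtration_term[of 1 0] by (simp del: sz_filtration.simps)
  then show ?case
    using sz_filtration_0[of 1] by (intro exI[of _ 1] bexI[of _ 1] bexI[of _ 0]) auto
next
  case (add a a')
  then obtain n b1 b2 b3 b4 m c1 c2 c3 c4 where
    b: "b1 \<in> sz_filtration n" "b2 \<in> sz_filtration n" "b3 \<in> sz_filtration n" "b4 \<in> sz_filtration n"
    "a = b1 + sj_x * b2 + sj_y * b3 + sj_x * sj_y * b4" and
    c: "c1 \<in> sz_filtration m" "c2 \<in> sz_filtration m" "c3 \<in> sz_filtration m" "c4 \<in> sz_filtration m"
    "a' = c1 + sj_x * c2 + sj_y * c3 + sj_x * sj_y * c4" by auto
  have mem: "b + c \<in> sz_filtration (max n m)"
    if "b \<in> sz_filtration n" "c \<in> sz_filtration m" for b c :: "'k super_jordan"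
    using sz_filtration_mono[OF max.cobounded1 that(1)] sz_filtration_mono[OF max.cobounded2 that(2)]
    by (rule sz_filtration_add)
  have "a + a' = (b1 + c1) + sj_x * (b2 + c2) + sj_y * (b3 + c3) + sj_x * sj_y * (b4 + c4)"
    by (simp add: b(5) c(5) algebra_simps)
  with mem b c show ?case by blast
next
  case (const c a)
  then obtain n b1 b2 b3 b4 where
    b: "b1 \<in> sz_filtration n" "b2 \<in> sz_filtration n" "b3 \<in> sz_filtration n" "b4 \<in> sz_filtration n"
    "a = b1 + sj_x * b2 + sj_y * b3 + sj_x * sj_y * b4" by auto
  have mem: "sj_const c * b \<in> sz_filtration n" if "b \<in> sz_filtration n" for b
    using sz_filtration_s_poly_mult[OF that, of "[:c:]"] by (simp add: sj_poly_const)
  have comm: "sj_const c * (u * b) = u * (sj_const c * b)" for u b :: "'k super_jordan"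
    by (metis mult.assoc sj_const_commute)
  have "sj_const c * a = sj_const c * b1 + sj_x * (sj_const c * b2) + sj_y * (sj_const c * b3) +
      sj_x * sj_y * (sj_const c * b4)"
    by (simp only: b(5) distrib_left comm)
  with mem b show ?case by blast
next
  case (x a)
  then obtain n b1 b2 b3 b4 where
    b: "b1 \<in> sz_filtration n" "b2 \<in> sz_filtration n" "b3 \<in> sz_filtration n" "b4 \<in> sz_filtration n"
    "a = b1 + sj_x * b2 + sj_y * b3 + sj_x * sj_y * b4" by auto
  have "sj_x * a = 0 + sj_x * b1 + sj_y * 0 + sj_x * sj_y * b3"
    by (simp add: b(5) distrib_left sj_x_x_left mult.assoc)
  with b sz_filtration_0 show ?case by blast
next
  case (y a)
  then obtain n b1 b2 b3 b4 where
    b: "b1 \<in> sz_filtration n" "b2 \<in> sz_filtration n" "b3 \<in> sz_filtration n" "b4 \<in> sz_filtration n"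
    "a = b1 + sj_x * b2 + sj_y * b3 + sj_x * sj_y * b4" by auto
  have "sj_y * a = sj_y * b1 + (sj_y * sj_x) * b2 + sj_z * b3 + (sj_y * sj_x) * sj_y * b4"
    by (simp only: b(5) distrib_left sj_z_def mult.assoc)
  \<comment> \<open>Combines \<open>y x = s - x y\<close> with \<open>s y = y s - x s\<close>, so
    that \<open>s\<close> and \<open>z\<close> stand on the right again.\<close>
  also have "(sj_y * sj_x) * sj_y = sj_y * sj_s - sj_x * sj_s - sj_x * (sj_z :: 'k super_jordan)"
    unfolding sj_y_x sj_y_s by (simp add: algebra_simps sj_z_def)
  also have "sj_y * b1 + (sj_y * sj_x) * b2 + sj_z * b3 + (sj_y * sj_s - sj_x * sj_s - sj_x * sj_z) * b4 =
    (sj_s * b2 + sj_z * b3) + sj_x * (- (sj_s * b4) - sj_z * b4) + sj_y * (b1 + sj_s * b4) + sj_x * sj_y * (- b2)"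
    unfolding sj_y_x by (simp add: algebra_simps)
  finally have "sj_y * a =
    (sj_s * b2 + sj_z * b3) + sj_x * (- (sj_s * b4) - sj_z * b4) + sj_y * (b1 + sj_s * b4) + sj_x * sj_y * (- b2)" .
  moreover have "sj_s * b2 + sj_z * b3 \<in> sz_filtration (Suc n)" "- (sj_s * b4) - sj_z * b4 \<in> sz_filtration (Suc n)"
    "b1 + sj_s * b4 \<in> sz_filtration (Suc n)" "- b2 \<in> sz_filtration (Suc n)"
    by (intro sz_filtration_add sz_filtration_diff sz_filtration_uminus sz_filtration_s_mult
        sz_filtration_z_mult b(1-4)[THEN sz_filtration_SucI] b)+
  ultimately show ?case by blast
qed

text \<open>Left multiplication by \<open>x\<close> removes \<open>b2\<close> and \<open>b4\<close>;
  right multiplication by \<open>x\<close> then removes \<open>b1\<close>, since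
  \<open>x B x\<close> lies in \<open>x x B = 0\<close>. Hence the order \<open>b3\<close>,
  \<open>b1\<close>, \<open>b4\<close>, \<open>b2\<close>: each test uses that the earlier
  components vanish.\<close>

lemma nonzero_ideal_contains_s_power:
  assumes I: "ideal I (ring_of_type_algebra :: 'k :: {field, ring_char_0} super_jordan ring)"
    and "I \<noteq> {0}"
  shows "\<exists>k. sj_s ^ k \<in> I"
proof -
  obtain a where a: "a \<in> I" "a \<noteq> 0" using assms ideal_zero[OF I] by auto
  obtain n b1 b2 b3 b4 where
    b: "b1 \<in> sz_filtration n" "b2 \<in> sz_filtration n" "b3 \<in> sz_filtration n" "b4 \<in> sz_filtration n"
    and eq: "a = b1 + sj_x * b2 + sj_y * b3 + sj_x * sj_y * b4"
    using super_jordan_decomposition[of a] by blast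
  have xa: "sj_x * a = sj_x * b1 + sj_x * sj_y * b3"
    by (simp add: eq distrib_left sj_x_x_left mult.assoc)
  have xbx: "sj_x * c * sj_x = 0" if c: "c \<in> sz_filtration n" for c :: "'k super_jordan"
  proof -
    obtain d where "c * sj_x = sj_x * d" using sz_filtration_mult_x[OF c] by blast
    then show ?thesis by (simp add: mult.assoc sj_x_x_left)
  qed
  have xaI: "sj_x * a \<in> I" by (rule ideal_mult_left[OF I a(1)])
  show ?thesis
  proof (cases "b3 = 0")
    case False
    have "sj_x * a * sj_x = sj_x * sj_y * b3 * sj_x"
      unfolding xa by (simp add: distrib_right xbx[OF b(1)])
    with ideal_mult_right[OF I xaI, of sj_x] x_y_sz_x_imp_s_power[OF I _ b(3) False]
    show ?thesis by simp
  next
    case b3: True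
    show ?thesis
    proof (cases "b1 = 0")
      case False
      with xa xaI b3 x_sz_imp_s_power[OF I _ b(1)] show ?thesis by simp
    next
      case b1: True
      show ?thesis
      proof (cases "b4 = 0")
        case False
        have "a * sj_x = sj_x * sj_y * b4 * sj_x"
          by (simp add: eq b1 b3 distrib_right xbx[OF b(2)])
        with ideal_mult_right[OF I a(1), of sj_x] x_y_sz_x_imp_s_power[OF I _ b(4) False]
        show ?thesis by simp
      next
        case True
        then have "a = sj_x * b2" by (simp add: eq b1 b3)
        then have "sj_x * b2 \<in> I" "b2 \<noteq> 0" using a by auto
        with x_sz_imp_s_power[OF I _ b(2)] show ?thesis by blast
      qed
    qed
  qed
qed

section \<open>Simple modules and primitive ideals\<close>

text \<open>The type \<open>'v\<close> is free here: \<open>primitive_ideal_annihilator\<close>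
  transfers the module to the element type fixed in \<open>primitive_ideal\<close>.\<close>

lemma primitive_ideal_of_action:
  fixes \<rho> :: "'r :: ring_1 \<Rightarrow> 'v :: ab_group_add \<Rightarrow> 'v"
  assumes one: "\<And>v. \<rho> 1 v = v"
    and mult: "\<And>a b v. \<rho> (a * b) v = \<rho> a (\<rho> b v)"
    and add: "\<And>a b v. \<rho> (a + b) v = \<rho> a v + \<rho> b v"
    and vadd: "\<And>a v w. \<rho> a (v + w) = \<rho> a v + \<rho> a w"
    and nontrivial: "(v\<^sub>0 :: 'v) \<noteq> 0"
    and simple: "\<And>N v. \<lbrakk>\<And>v w. v \<in> N \<Longrightarrow> w \<in> N \<Longrightarrow> v + w \<in> N; \<And>a v. v \<in> N \<Longrightarrow> \<rho> a v \<in> N;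
        v \<in> N; v \<noteq> 0\<rbrakk> \<Longrightarrow> N = UNIV"
  shows "primitive_ideal (ring_of_type_algebra :: 'r ring) {a. \<forall>v. \<rho> a v = 0}"
proof -
  let ?R = "ring_of_type_algebra :: 'r ring"
  define M :: "('r, 'v) module" where
    "M = \<lparr>carrier = UNIV, monoid.mult = (\<lambda>u v. u), one = 0, ring.zero = 0, add = (+), module.smult = \<rho>\<rparr>"
  have M_simps: "carrier M = UNIV" "\<zero>\<^bsub>M\<^esub> = 0" "u \<oplus>\<^bsub>M\<^esub> v = u + v" "a \<odot>\<^bsub>M\<^esub> u = \<rho> a u" for a u v
    by (simp_all add: M_def)
  have grp: "abelian_group M"
  proof (rule abelian_groupI)
    fix u
    show "\<exists>v\<in>carrier M. v \<oplus>\<^bsub>M\<^esub> u = \<zero>\<^bsub>M\<^esub>"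
      by (intro bexI[of _ "- u"]) (simp_all add: M_simps)
  qed (simp_all add: M_simps add_ac)
  interpret M: left_module ?R M
    by (intro left_module.intro left_module_axioms.intro grp ring_ring_of_type_algebra)
      (simp_all add: M_simps one mult add vadd)
  have "simple_left_module ?R M"
  proof (intro simple_left_module.intro simple_left_module_axioms.intro M.left_module_axioms)
    show "carrier M \<noteq> {\<zero>\<^bsub>M\<^esub>}" using nontrivial by (auto simp: M_simps)
  next
    fix N assume "submodule N ?R M"
    then have sub: "subgroup N (add_monoid M)" and cl: "\<forall>a. \<forall>u\<in>N. \<rho> a u \<in> N"
      by (auto simp: submodule_def submodule_axioms_def M_simps)
    have zero: "0 \<in> N" using subgroup.one_closed[OF sub] by (simp add: M_simps)
    have "N = UNIV" if neq: "N \<noteq> {0}"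
    proof -
      have "\<not> N \<subseteq> {0}" using neq zero by auto
      then obtain v where v: "v \<in> N" "v \<noteq> 0" by auto
      show ?thesis
      proof (rule simple[OF _ _ v])
        show "v + w \<in> N" if "v \<in> N" "w \<in> N" for v w
          using subgroup.m_closed[OF sub that] by (simp add: M_simps)
        show "\<rho> a v \<in> N" if "v \<in> N" for a v
          using cl that by blast
      qed
    qed
    then show "N = {\<zero>\<^bsub>M\<^esub>} \<or> N = carrier M" unfolding M_simps by blast
  qed
  then have "primitive_ideal ?R (annihilator ?R M)" by (rule primitive_ideal_annihilator)
  then show ?thesis by (simp add: annihilator_def M_simps)
qed

section \<open>The faithful simple module\<close>

definition poly_shift :: "'k :: field poly \<Rightarrow> 'k poly" where
  "poly_shift f = pcompose f [:-1, 1:]"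

lemma poly_shift_simps:
  "poly_shift (f + g) = poly_shift f + poly_shift g"
  "poly_shift (smult c f) = smult c (poly_shift f)"
  "poly_shift 0 = 0" "poly_shift 1 = 1"
  by (simp_all add: poly_shift_def pcompose_add pcompose_smult pcompose_1)

lemma poly_shift_u_mult: "poly_shift ([:0, 1:] * f) = [:0, 1:] * poly_shift f - poly_shift f"
  by (simp add: poly_shift_def pcompose_pCons)

lemma poly_shift_eq_0_iff: "poly_shift f = 0 \<longleftrightarrow> f = 0"
  by (simp add: poly_shift_def pcompose_eq_0_iff)

lemma degree_poly_shift: "degree (poly_shift f) = degree f"
  by (simp add: poly_shift_def degree_pcompose)

lemma poly_shift_preimage: "\<exists>g. poly_shift g = f \<and> degree g = degree f"
proof -
  have "poly_shift (pcompose f [:1, 1:]) = f"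
    unfolding poly_shift_def pcompose_assoc[symmetric] by (simp add: pcompose_pCons)
  then show ?thesis by (metis degree_poly_shift)
qed

text \<open>A polynomial of period 1 takes the value \<open>f(0)\<close> at all naturals, which are
  infinitely many points in characteristic zero.\<close>

lemma poly_shift_fixed_imp_constant:
  fixes f :: "'k :: field_char_0 poly"
  assumes "poly_shift f = f"
  shows "degree f = 0"
proof -
  have step: "poly f (a - 1) = poly f a" for a
    using arg_cong[OF assms, of "\<lambda>p. poly p a"] by (simp add: poly_shift_def poly_pcompose)
  have nat: "poly f (of_nat n) = poly f 0" for n
    by (induction n) (use step[of "of_nat (Suc _)"] in auto)
  have "f - [:poly f 0:] = 0"
  proof (rule ccontr)
    assume "f - [:poly f 0:] \<noteq> 0"
    then have "finite {a. poly (f - [:poly f 0:]) a = 0}" by (rule poly_roots_finite)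
    moreover have "range of_nat \<subseteq> {a. poly (f - [:poly f 0:]) a = 0}" using nat by auto
    ultimately have "finite (range (of_nat :: nat \<Rightarrow> 'k))" by (rule rev_finite_subset)
    then show False by (simp add: finite_image_iff inj_of_nat)
  qed
  then have "f = [:poly f 0:]" by simp
  then show ?thesis by (metis degree_pCons_0)
qed

text \<open>Substituting the monic \<open>u - 1\<close> preserves the leading coefficient, so it
  cancels in the difference.\<close>

lemma degree_poly_shift_diff_less:
  assumes "degree f > 0"
  shows "degree (f - poly_shift f) < degree f"
proof -
  have "coeff (f - poly_shift f) (degree f) = 0"
    using lead_coeff_comp[of "[:-1, 1 :: 'a:]" f] degree_poly_shift[of f] by (simp add: poly_shift_def)
  moreover have "degree (f - poly_shift f) \<le> degree f"
    by (intro degree_diff_le) (simp_all add: degree_poly_shift)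
  ultimately show ?thesis
    using assms by (metis leading_coeff_0_iff degree_0 order_le_less)
qed

text \<open>
  A faithful simple module: on \<open>k[u]\<^sup>2\<close> let \<open>x (f, g) = (g, 0)\<close> and \<open>y (f, g) = (u g, f(u - 1))\<close>, so
  that \<open>s\<close> acts as the shift \<open>u \<mapsto> u - 1\<close> in both components.
\<close>

definition shift_act :: "'k :: field super_jordan \<Rightarrow> 'k poly \<times> 'k poly \<Rightarrow> 'k poly \<times> 'k poly" where
  "shift_act = sj_act (\<lambda>c v. (smult c (fst v), smult c (snd v))) (\<lambda>v. (snd v, 0))
     (\<lambda>v. ([:0, 1:] * snd v, poly_shift (fst v)))"

text \<open>The relation for \<open>y^2 x\<close> amounts to
  \<open>u g(u-1) = (u-1) g(u-1) + g(u-1)\<close> in the first component.\<close>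

interpretation shift: sj_action "\<lambda>(c :: 'k :: field) v. (smult c (fst v), smult c (snd v))" "\<lambda>v. (snd v, 0)"
    "\<lambda>v. ([:0, 1:] * snd v, poly_shift (fst v))"
  rewrites "sj_act (\<lambda>(c :: 'k) v. (smult c (fst v), smult c (snd v))) (\<lambda>v. (snd v, 0))
     (\<lambda>v. ([:0, 1:] * snd v, poly_shift (fst v))) = shift_act"
proof -
  show "sj_action (\<lambda>(c :: 'k) v. (smult c (fst v), smult c (snd v))) (\<lambda>v. (snd v, 0))
    (\<lambda>v. ([:0, 1:] * snd v, poly_shift (fst v)))"
    by unfold_locales
      (simp_all only: fst_add snd_add fst_conv snd_conv poly_shift_u_mult poly_shift_simps add_Pair
        smult_add_left smult_add_right smult_smult smult_1_left smult_0_right mult_smult_right distrib_left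
        mult_zero_right add_0_left add_0_right diff_add_cancel prod.collapse zero_prod_def)
qed (simp add: shift_act_def)

lemma shift_act_s: "shift_act sj_s v = (poly_shift (fst v), poly_shift (snd v))"
  by (simp add: sj_s_def shift.act_add shift.act_mult shift.act_x shift.act_y poly_shift_simps)

lemma s_power_not_annihilator: "shift_act (sj_s ^ n) (1, 0) = (1, 0)"
  by (induction n) (simp_all add: shift.act_one shift.act_mult shift_act_s poly_shift_simps)

text \<open>Any nonzero vector yields some nonzero \<open>(f, 0)\<close>; the difference operator
  \<open>1 - s\<close> lowers its degree down to a constant, and \<open>y y\<close> and
  \<open>y\<close> rebuild everything from \<open>(1, 0)\<close>.\<close>

lemma shift_act_simple:
  fixes N :: "('k :: field_char_0 poly \<times> 'k poly) set"
  assumes add: "\<And>v w. v \<in> N \<Longrightarrow> w \<in> N \<Longrightarrow> v + w \<in> N"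
    and act: "\<And>a v. v \<in> N \<Longrightarrow> shift_act a v \<in> N"
    and v: "v \<in> N" "v \<noteq> 0"
  shows "N = UNIV"
proof -
  have x: "(snd v, 0) \<in> N" if "v \<in> N" for v
    using act[OF that, of sj_x] by (simp add: shift.act_x)
  have y: "([:0, 1:] * snd v, poly_shift (fst v)) \<in> N" if "v \<in> N" for v
    using act[OF that, of sj_y] unfolding shift.act_y .
  have const: "(smult c f, 0) \<in> N" if "(f, 0) \<in> N" for c f
    using act[OF that, of "sj_const c"] by (simp add: shift.act_const)
  have "\<exists>f. f \<noteq> 0 \<and> (f, 0) \<in> N"
  proof (cases "snd v = 0")
    case False
    with x[OF v(1)] show ?thesis by blast
  next
    case True
    then have "fst v \<noteq> 0" using v(2) by (metis prod.collapse zero_prod_def)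
    moreover have "(poly_shift (fst v), 0) \<in> N" using x[OF y[OF v(1)]] by simp
    ultimately show ?thesis using poly_shift_eq_0_iff by blast
  qed
  then obtain f where f: "f \<noteq> 0" "(f, 0) \<in> N" by blast
  then have one: "(1, 0) \<in> N"
  proof (induction "degree f" arbitrary: f rule: less_induct)
    case less
    show ?case
    proof (cases "degree f = 0")
      case True
      then obtain c where c: "f = [:c:]" "c \<noteq> 0" using less.prems(1) by (auto elim: degree_eq_zeroE)
      then show ?thesis using const[OF less.prems(2), of "inverse c"] by (simp add: one_pCons)
    next
      case False
      let ?g = "f - poly_shift f"
      have "shift_act (1 - sj_s) (f, 0) \<in> N" using act less.prems(2) by blast
      then have "(?g, 0) \<in> N" by (simp add: shift.act_diff shift.act_one shift_act_s poly_shift_simps)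
      moreover have "?g \<noteq> 0" using False poly_shift_fixed_imp_constant[of f] by auto
      ultimately show ?thesis using less.hyps degree_poly_shift_diff_less False by blast
    qed
  qed
  have fst_N: "(h, 0) \<in> N" for h
  proof (induction "degree h" arbitrary: h rule: less_induct)
    case less
    obtain c h' where h: "h = pCons c h'" by (cases h)
    have c: "([:c:], 0) \<in> N" using const[OF one, of c] by simp
    show ?case
    proof (cases "h' = 0")
      case True
      with c h show ?thesis by simp
    next
      case False
      \<comment> \<open>\<open>y y\<close> maps \<open>(g, 0)\<close> to
        \<open>(u g(u-1), 0)\<close>, so a preimage of \<open>h'\<close> under the shift is what
        produces \<open>u h'\<close>.\<close>
      obtain g where g: "poly_shift g = h'" "degree g = degree h'" using poly_shift_preimage by blast
      have "(g, 0) \<in> N" using less g h False by simp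
      then have "([:0, 1:] * h', 0) \<in> N" using y[OF y] g(1) by (fastforce simp: poly_shift_simps)
      from add[OF c this] show ?thesis by (simp add: h)
    qed
  qed
  have snd_N: "(0, h) \<in> N" for h
  proof -
    obtain g where "poly_shift g = h" using poly_shift_preimage by blast
    with y[OF fst_N[of g]] show ?thesis by simp
  qed
  have "w \<in> N" for w
    using add[OF fst_N[of "fst w"] snd_N[of "snd w"]] by simp
  then show ?thesis by blast
qed

text \<open>The annihilator is an ideal without any power of \<open>s\<close>, because the shift
  fixes the vector \<open>(1, 0)\<close>; only the zero ideal has this property.\<close>

lemma primitive_ideal_zero:
  "primitive_ideal (ring_of_type_algebra :: 'k :: field_char_0 super_jordan ring) {0}"
proof -
  let ?P = "{a :: 'k super_jordan. \<forall>v. shift_act a v = 0}"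
  have prim: "primitive_ideal ring_of_type_algebra ?P"
    by (rule primitive_ideal_of_action[where v\<^sub>0 = "(1, 0)"])
      (simp_all add: shift.act_one shift.act_mult shift.act_add shift.act_vadd zero_prod_def,
        rule shift_act_simple, auto simp: zero_prod_def)
  have "ideal ?P ring_of_type_algebra"
    unfolding ideal_ring_of_type_algebra_iff
    by (simp add: shift.act_0 shift.act_add shift.act_mult shift.act_v0 del: split_paired_All)
  moreover have "sj_s ^ n \<notin> ?P" for n
  proof
    assume "sj_s ^ n \<in> ?P"
    then have "shift_act (sj_s ^ n) (1, 0) = (0 :: 'k poly \<times> 'k poly)" by blast
    then show False unfolding s_power_not_annihilator zero_prod_def by simp
  qed
  ultimately have "?P = {0}"
    using nonzero_ideal_contains_s_power[of ?P] by blast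
  with prim show ?thesis by simp
qed

lemma sj_s_neq_0: "sj_s \<noteq> (0 :: 'k :: field_char_0 super_jordan)"
proof
  assume "sj_s = (0 :: 'k super_jordan)"
  then have "shift_act (sj_s ^ 1) (1, 0) = (0 :: 'k poly \<times> 'k poly)" by (simp only: power_one_right shift.act_0)
  then show False unfolding s_power_not_annihilator zero_prod_def by simp
qed

section \<open>The quotient by \<open>\<langle>s, x\<rangle>\<close>\<close>

text \<open>The homomorphism onto \<open>k[y]\<close> killing \<open>x\<close>, read off from the
  action on \<open>k[y]\<close> by applying it to the generator 1.\<close>

definition sj_eval :: "'k :: field super_jordan \<Rightarrow> 'k poly" where
  "sj_eval a = sj_act smult (\<lambda>_. 0) ((*) [:0, 1:]) a 1"

interpretation eval: sj_action smult "\<lambda>_. 0" "(*) [:0, 1 :: 'k :: field:]"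
  by unfold_locales (simp_all add: smult_add_left smult_add_right mult_pCons_left algebra_simps)

lemma eval_act: "sj_act smult (\<lambda>_. 0) ((*) [:0, 1:]) a f = sj_eval a * f"
  unfolding sj_eval_def
  by (induction a rule: super_jordan_induct)
    (simp_all only: eval.act_one eval.act_add eval.act_mult eval.act_const eval.act_x eval.act_y
      mult_1_left distrib_right mult_smult_left mult_zero_left mult.assoc)

lemma sj_eval_simps [simp]:
  fixes a b :: "'k :: field super_jordan"
  shows "sj_eval 0 = (0 :: 'k poly)" "sj_eval 1 = (1 :: 'k poly)"
    "sj_eval (a + b) = sj_eval a + sj_eval b" "sj_eval (a - b) = sj_eval a - sj_eval b"
    "sj_eval (a * b) = sj_eval a * sj_eval b" "sj_eval (sj_const c) = [:c:]"
    "sj_eval sj_x = (0 :: 'k poly)" "sj_eval sj_y = [:0, 1 :: 'k:]"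
proof -
  show "sj_eval (a * b) = sj_eval a * sj_eval b"
    unfolding eval_act[symmetric] by (simp only: sj_eval_def eval.act_mult)
qed (simp_all add: sj_eval_def eval.act_0 eval.act_one eval.act_add eval.act_diff eval.act_const
    eval.act_x eval.act_y)

lemma sj_eval_s [simp]: "sj_eval sj_s = 0"
  by (simp add: sj_s_def)

lemma ideal_Idl: "ideal (Idl\<^bsub>ring_of_type_algebra\<^esub> S) (ring_of_type_algebra :: 'a :: ring_1 ring)"
  by (rule ring.genideal_ideal[OF ring_ring_of_type_algebra]) simp

lemma Idl_member: "a \<in> S \<Longrightarrow> a \<in> Idl\<^bsub>ring_of_type_algebra\<^esub> (S :: 'a :: ring_1 set)"
  using ring.genideal_self[OF ring_ring_of_type_algebra, of S] by auto

lemma Idl_subset: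
  "ideal I (ring_of_type_algebra :: 'a :: ring_1 ring) \<Longrightarrow> S \<subseteq> I \<Longrightarrow> Idl\<^bsub>ring_of_type_algebra\<^esub> S \<subseteq> I"
  by (rule ring.genideal_minimal[OF ring_ring_of_type_algebra])

text \<open>Modulo \<open>x\<close> every element is a polynomial in \<open>y\<close>. The ideal is
  arbitrary so that the claim covers both the generated ideals and an unknown prime.\<close>

lemma diff_sj_poly_eval_mem:
  assumes I: "ideal I (ring_of_type_algebra :: 'k :: field super_jordan ring)" and x: "sj_x \<in> I"
  shows "a - sj_poly sj_y (sj_eval a) \<in> I"
proof (induction a rule: super_jordan_induct)
  case (add a b)
  then show ?case using ideal_add[OF I add] by (simp add: sj_poly_add algebra_simps)
next
  case (const c a)
  show ?case using ideal_mult_left[OF I const, of "sj_const c"] by (simp add: sj_poly_smult algebra_simps)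
next
  case (x a)
  show ?case using ideal_mult_right[OF I assms(2)] by simp
next
  case (y a)
  show ?case using ideal_mult_left[OF I y, of sj_y] by (simp add: sj_poly_pCons sj_const_0 algebra_simps)
qed (simp add: ideal_zero[OF I])

lemma Idl_s_x_eq: "Idl\<^bsub>ring_of_type_algebra\<^esub> {sj_s, sj_x} = {a :: 'k :: field super_jordan. sj_eval a = 0}"
  (is "?I = ?K")
proof
  have "ideal ?K ring_of_type_algebra"
    unfolding ideal_ring_of_type_algebra_iff by auto
  then show "?I \<subseteq> ?K" by (rule Idl_subset) auto
  show "?K \<subseteq> ?I"
  proof
    fix a :: "'k super_jordan" assume "a \<in> ?K"
    moreover have "a - sj_poly sj_y (sj_eval a) \<in> ?I"
      by (rule diff_sj_poly_eval_mem[OF ideal_Idl Idl_member]) simp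
    ultimately show "a \<in> ?I" by simp
  qed
qed

lemma sj_poly_y_linear_mult:
  "sj_poly sj_y ([:- \<alpha>, 1:] * q) = (sj_y - sj_const \<alpha>) * sj_poly sj_y q"
proof -
  have "sj_const (- \<alpha>) = - sj_const \<alpha>"
    using sj_const_add[of "- \<alpha>" \<alpha>] by (simp add: sj_const_0 eq_neg_iff_add_eq_0)
  then show ?thesis by (simp only: sj_poly_mult) (simp add: sj_poly_pCons sj_const_1)
qed

lemma Idl_s_x_y_eq:
  "Idl\<^bsub>ring_of_type_algebra\<^esub> {sj_s, sj_x, sj_y - sj_const \<alpha>} =
    {a :: 'k :: field super_jordan. poly (sj_eval a) \<alpha> = 0}"
  (is "?I = ?K")
proof
  have "ideal ?K ring_of_type_algebra"
    unfolding ideal_ring_of_type_algebra_iff by auto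
  then show "?I \<subseteq> ?K" by (rule Idl_subset) auto
  show "?K \<subseteq> ?I"
  proof
    fix a assume "a \<in> ?K"
    then obtain q where q: "sj_eval a = [:- \<alpha>, 1:] * q" by (auto simp: poly_eq_0_iff_dvd)
    have "a - sj_poly sj_y (sj_eval a) \<in> ?I"
      by (rule diff_sj_poly_eval_mem[OF ideal_Idl Idl_member]) simp
    moreover have "sj_poly sj_y (sj_eval a) \<in> ?I"
      unfolding q sj_poly_y_linear_mult by (rule ideal_mult_right[OF ideal_Idl Idl_member]) simp
    ultimately show "a \<in> ?I" using ideal_add[OF ideal_Idl] by fastforce
  qed
qed

section \<open>The ideals of the points and of the line\<close>

lemma maximalideal_point:
  "maximalideal {a :: 'k :: field super_jordan. poly (sj_eval a) \<alpha> = 0} ring_of_type_algebra"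
  (is "maximalideal ?K ?R")
proof (intro maximalideal.intro maximalideal_axioms.intro)
  show "ideal ?K ?R" unfolding ideal_ring_of_type_algebra_iff by auto
  have "1 \<notin> ?K" by simp
  then show "carrier ?R \<noteq> ?K" by (metis UNIV_I ring_of_type_algebra_simps(1))
  fix L assume L: "ideal L ?R" "?K \<subseteq> L"
  have "L = UNIV" if neq: "L \<noteq> ?K"
  proof -
    obtain a where a: "a \<in> L" "poly (sj_eval a) \<alpha> \<noteq> 0" using neq L(2) by blast
    let ?c = "poly (sj_eval a) \<alpha>"
    \<comment> \<open>An element outside \<open>?K\<close> differs from a nonzero scalar by an
      element of \<open>?K\<close>.\<close>
    have "a - sj_const ?c \<in> L" using L(2) by auto
    then have "sj_const ?c \<in> L" using ideal_diff[OF L(1) a(1)] by fastforce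
    then have "sj_const (inverse ?c) * sj_const ?c \<in> L" by (rule ideal_mult_left[OF L(1)])
    then have "1 \<in> L" using a(2) by (simp add: sj_const_1 flip: sj_const_mult)
    then show ?thesis using ideal_eq_UNIV_iff[OF L(1)] by simp
  qed
  then show "L = ?K \<or> L = carrier ?R" by auto
qed

lemma completely_prime_ideal_point:
  "completely_prime_ideal ring_of_type_algebra {a :: 'k :: field super_jordan. poly (sj_eval a) \<alpha> = 0}"
  by (rule completely_prime_idealI) (auto simp: ideal_ring_of_type_algebra_iff)

lemma completely_prime_ideal_line:
  "completely_prime_ideal ring_of_type_algebra {a :: 'k :: field super_jordan. sj_eval a = 0}"
  by (rule completely_prime_idealI) (auto simp: ideal_ring_of_type_algebra_iff)

text \<open>The simple module is the field itself, with \<open>y\<close> acting as \<alpha> and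
  \<open>x\<close> as 0.\<close>

lemma primitive_ideal_point:
  "primitive_ideal ring_of_type_algebra {a :: 'k :: field super_jordan. poly (sj_eval a) \<alpha> = 0}"
proof -
  have "primitive_ideal ring_of_type_algebra
      {a :: 'k super_jordan. \<forall>v. (\<lambda>a v. poly (sj_eval a) \<alpha> * v) a v = 0}"
  proof (rule primitive_ideal_of_action[where v\<^sub>0 = 1])
    fix N and v :: 'k
    assume act: "\<And>a v. v \<in> N \<Longrightarrow> poly (sj_eval a) \<alpha> * v \<in> N" and v: "v \<in> N" "v \<noteq> 0"
    have "w \<in> N" for w
      using act[OF v(1), of "sj_const (w / v)"] v(2) by simp
    then show "N = UNIV" by blast
  qed (simp_all add: algebra_simps)
  moreover have "(\<forall>v. poly (sj_eval a) \<alpha> * v = 0) \<longleftrightarrow> poly (sj_eval a) \<alpha> = 0" for a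
    by (auto dest: spec[of _ 1])
  ultimately show ?thesis by simp
qed

text \<open>Otherwise the commutative ring \<open>k[y]\<close> would act faithfully on a simple
  module. A nonzero vector \<open>m\<close> would then have annihilator zero in \<open>k[y]\<close>,
  and \<open>m = a y m\<close> would make \<open>y\<close> invertible there.\<close>

lemma not_primitive_ideal_line:
  "\<not> primitive_ideal ring_of_type_algebra {a :: 'k :: field super_jordan. sj_eval a = 0}"
proof
  let ?R = "ring_of_type_algebra :: 'k super_jordan ring"
  assume "primitive_ideal ?R {a :: 'k super_jordan. sj_eval a = 0}"
  then obtain M :: "('k super_jordan, 'k super_jordan set) module" where
    M: "simple_left_module ?R M" and ann: "annihilator ?R M = {a. sj_eval a = 0}"
    unfolding primitive_ideal_def by auto
  interpret M: simple_left_module ?R M by (rule M)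
  obtain m where m: "m \<in> carrier M" "m \<noteq> \<zero>\<^bsub>M\<^esub>"
    using M.nontrivial M.M.zero_closed by blast
  have kill: "a \<odot>\<^bsub>M\<^esub> n = \<zero>\<^bsub>M\<^esub>" if "sj_eval a = 0" "n \<in> carrier M" for a n
    using that ann by (auto simp: annihilator_def)
  have closed: "a \<odot>\<^bsub>M\<^esub> n \<in> carrier M" if "n \<in> carrier M" for a n
    using M.smult_closed[of a n] that by simp
  have assoc: "(a * b) \<odot>\<^bsub>M\<^esub> n = a \<odot>\<^bsub>M\<^esub> (b \<odot>\<^bsub>M\<^esub> n)" if "n \<in> carrier M" for a b n
    using M.smult_assoc[of a b n] that by simp
  have distr: "(a + b) \<odot>\<^bsub>M\<^esub> n = a \<odot>\<^bsub>M\<^esub> n \<oplus>\<^bsub>M\<^esub> b \<odot>\<^bsub>M\<^esub> n" if "n \<in> carrier M" for a b n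
    using M.smult_l_distr[of a b n] that by simp
  have a0: "a \<odot>\<^bsub>M\<^esub> \<zero>\<^bsub>M\<^esub> = \<zero>\<^bsub>M\<^esub>" for a
    using M.smult_zero[of a] by simp
  have eval_0: "sj_eval b = 0" if b: "b \<odot>\<^bsub>M\<^esub> m = \<zero>\<^bsub>M\<^esub>" for b
  proof -
    have "b \<odot>\<^bsub>M\<^esub> n = \<zero>\<^bsub>M\<^esub>" if n: "n \<in> carrier M" for n
    proof -
      obtain r where r: "n = r \<odot>\<^bsub>M\<^esub> m" using M.cyclic[OF m] n by auto
      \<comment> \<open>Commutators evaluate to 0 in \<open>k[y]\<close> and so act as zero; hence
        \<open>b\<close> kills \<open>r m\<close> along with \<open>m\<close>.\<close>
      have "b * r = r * b + (b * r - r * b)" by simp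
      then have "b \<odot>\<^bsub>M\<^esub> n = (r * b + (b * r - r * b)) \<odot>\<^bsub>M\<^esub> m"
        unfolding r assoc[OF m(1), symmetric] by simp
      also have "\<dots> = (r * b) \<odot>\<^bsub>M\<^esub> m \<oplus>\<^bsub>M\<^esub> (b * r - r * b) \<odot>\<^bsub>M\<^esub> m"
        by (rule distr[OF m(1)])
      also have "\<dots> = \<zero>\<^bsub>M\<^esub>"
        using kill[of "b * r - r * b" m] m by (simp add: assoc b a0)
      finally show ?thesis .
    qed
    then have "b \<in> annihilator ?R M" by (simp add: annihilator_def)
    then show ?thesis using ann by simp
  qed
  have "sj_y \<odot>\<^bsub>M\<^esub> m \<noteq> \<zero>\<^bsub>M\<^esub>" using eval_0[of sj_y] by auto
  with M.cyclic[OF closed[OF m(1)]] m(1) obtain a where a: "m = a \<odot>\<^bsub>M\<^esub> (sj_y \<odot>\<^bsub>M\<^esub> m)"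
    by (metis (no_types, lifting) imageE)
  have "(1 - a * sj_y) \<odot>\<^bsub>M\<^esub> m \<oplus>\<^bsub>M\<^esub> (a * sj_y) \<odot>\<^bsub>M\<^esub> m = m"
    unfolding distr[OF m(1), symmetric] using M.smult_one[OF m(1)] by simp
  then have "(1 - a * sj_y) \<odot>\<^bsub>M\<^esub> m \<oplus>\<^bsub>M\<^esub> m = m"
    by (simp add: assoc[OF m(1)] flip: a)
  then have "(1 - a * sj_y) \<odot>\<^bsub>M\<^esub> m = \<zero>\<^bsub>M\<^esub>"
    using closed[OF m(1), of "1 - a * sj_y"] m(1) by (simp add: M.M.add.r_cancel_one)
  then have "sj_eval (1 - a * sj_y) = 0" by (rule eval_0)
  then have "poly (1 - sj_eval a * [:0, 1:]) 0 = 0" by simp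
  then show False by simp
qed

section \<open>Nonzero prime ideals\<close>

lemma s_mem_nonzero_prime:
  fixes P :: "'k :: {field, ring_char_0} super_jordan set"
  assumes P: "prime_ideal ring_of_type_algebra P" "P \<noteq> {0}"
  shows "sj_s \<in> P"
proof -
  have I: "ideal P ring_of_type_algebra" and "P \<noteq> UNIV"
    and prime: "\<And>a b. (\<And>r. a * r * b \<in> P) \<Longrightarrow> a \<in> P \<or> b \<in> P"
    using P(1) unfolding prime_ideal_iff_elementwise by blast+
  have normal: "\<exists>r'. sj_s * r = r' * sj_s" for r :: "'k super_jordan"
  proof (induction r rule: super_jordan_induct)
    case one
    show ?case by (intro exI[of _ 1]) simp
  next
    case (add a b)
    then show ?case by (metis distrib_left distrib_right)
  next
    case (const c a)
    then show ?case by (metis mult.assoc sj_const_commute)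
  next
    case (x a)
    then show ?case by (metis mult.assoc sj_s_x)
  next
    case (y a)
    then obtain r' where r': "sj_s * a = r' * sj_s" by blast
    \<comment> \<open>\<open>sj_y_s\<close> rearranged: passing \<open>s\<close> twists
      \<open>y\<close> into \<open>y - x\<close>.\<close>
    have "sj_s * sj_y = (sj_y - sj_x) * (sj_s :: 'k super_jordan)"
      by (simp add: left_diff_distrib sj_y_s)
    then have "sj_s * (sj_y * a) = ((sj_y - sj_x) * r') * sj_s"
      by (metis mult.assoc r')
    then show ?case by blast
  qed
  obtain k where k: "sj_s ^ k \<in> P" using nonzero_ideal_contains_s_power[OF I P(2)] by blast
  then show ?thesis
  proof (induction k)
    case 0
    with \<open>P \<noteq> UNIV\<close> show ?case using ideal_eq_UNIV_iff[OF I] by simp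
  next
    case (Suc k)
    \<comment> \<open>Normality turns this product into \<open>r' s^(k+1)\<close>, so primeness
      lowers the exponent.\<close>
    have "sj_s * r * sj_s ^ k \<in> P" for r
    proof -
      obtain r' where "sj_s * r = r' * sj_s" using normal by blast
      then have "sj_s * r * sj_s ^ k = r' * sj_s ^ Suc k" by (simp add: mult.assoc)
      with ideal_mult_left[OF I Suc.prems] show ?thesis by simp
    qed
    with prime Suc.IH show ?case by blast
  qed
qed

lemma x_mem_nonzero_prime:
  fixes P :: "'k :: {field, ring_char_0} super_jordan set"
  assumes P: "prime_ideal ring_of_type_algebra P" "P \<noteq> {0}"
  shows "sj_x \<in> P"
proof -
  have I: "ideal P ring_of_type_algebra"
    and prime: "\<And>a b. (\<And>r. a * r * b \<in> P) \<Longrightarrow> a \<in> P \<or> b \<in> P"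
    using P(1) unfolding prime_ideal_iff_elementwise by blast+
  have s: "sj_s \<in> P" using s_mem_nonzero_prime[OF P] .
  have normal: "\<exists>r'. sj_x * r - r' * sj_x \<in> P" for r :: "'k super_jordan"
  proof (induction r rule: super_jordan_induct)
    case one
    show ?case using ideal_zero[OF I] by (intro exI[of _ 1]) simp
  next
    case (add a b)
    then obtain a' b' where "sj_x * a - a' * sj_x \<in> P" "sj_x * b - b' * sj_x \<in> P" by blast
    from ideal_add[OF I this] show ?case
      by (intro exI[of _ "a' + b'"]) (simp add: algebra_simps)
  next
    case (const c a)
    then obtain a' where "sj_x * a - a' * sj_x \<in> P" by blast
    from ideal_mult_left[OF I this, of "sj_const c"]
    have "sj_const c * (sj_x * a) - sj_const c * a' * sj_x \<in> P" by (simp add: algebra_simps)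
    also have "sj_const c * (sj_x * a) = sj_x * (sj_const c * a)" by (metis mult.assoc sj_const_commute)
    finally show ?case by blast
  next
    case (x a)
    show ?case using ideal_zero[OF I] by (intro exI[of _ 0]) (simp add: sj_x_x_left)
  next
    case (y a)
    then obtain a' where "sj_x * a - a' * sj_x \<in> P" by blast
    \<comment> \<open>Modulo \<open>s\<close> the generators anticommute, whence
      \<open>- (y a')\<close> as the new witness.\<close>
    from ideal_diff[OF I ideal_mult_right[OF I s, of a] ideal_mult_left[OF I this, of sj_y]]
    have "sj_x * (sj_y * a) - (- (sj_y * a')) * sj_x \<in> P"
      by (simp add: sj_s_def algebra_simps)
    then show ?case by blast
  qed
  have "sj_x * r * sj_x \<in> P" for r
  proof -
    obtain r' where "sj_x * r - r' * sj_x \<in> P" using normal by blast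
    from ideal_mult_right[OF I this, of sj_x] show ?thesis
      by (simp add: left_diff_distrib mult.assoc sj_x_x)
  qed
  with prime show ?thesis by blast
qed

text \<open>Modulo \<open>s\<close> and \<open>x\<close> only \<open>k[y]\<close> is left. A prime
  above the line contains a nonzero polynomial in \<open>y\<close>, primeness selects one of its
  linear factors, and maximality of the point ideal gives equality.\<close>

lemma nonzero_prime_classification:
  fixes P :: "'k :: {alg_closed_field, field_char_0} super_jordan set"
  assumes P: "prime_ideal ring_of_type_algebra P" "P \<noteq> {0}"
  shows "P = {a. sj_eval a = 0} \<or> (\<exists>\<alpha>. P = {a. poly (sj_eval a) \<alpha> = 0})"
proof -
  have I: "ideal P ring_of_type_algebra" and proper: "P \<noteq> UNIV"
    and prime: "\<And>a b. (\<And>r. a * r * b \<in> P) \<Longrightarrow> a \<in> P \<or> b \<in> P"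
    using P(1) unfolding prime_ideal_iff_elementwise by blast+
  have s: "sj_s \<in> P" and x: "sj_x \<in> P"
    using s_mem_nonzero_prime[OF P] x_mem_nonzero_prime[OF P] .
  have line: "{a. sj_eval a = 0} \<subseteq> P"
    unfolding Idl_s_x_eq[symmetric] by (rule Idl_subset[OF I]) (use s x in auto)
  have linear: "\<exists>\<alpha>. sj_y - sj_const \<alpha> \<in> P" if "f \<noteq> 0" "sj_poly sj_y f \<in> P" for f
    using that
  proof (induction "degree f" arbitrary: f rule: less_induct)
    case (less f)
    show ?case
    proof (cases "degree f = 0")
      case True
      then obtain c where c: "f = [:c:]" "c \<noteq> 0" using less.prems(1) by (auto elim: degree_eq_zeroE)
      then have "sj_const (inverse c) * sj_const c \<in> P"
        using less.prems(2) by (intro ideal_mult_left[OF I]) (simp add: sj_poly_const)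
      then have "1 \<in> P" using c(2) by (simp add: sj_const_1 flip: sj_const_mult)
      then show ?thesis using proper ideal_eq_UNIV_iff[OF I] by simp
    next
      case False
      then obtain \<alpha> where "poly f \<alpha> = 0" using alg_closed_imp_poly_has_root[of f] by auto
      then obtain q where q: "f = [:- \<alpha>, 1:] * q" by (auto simp: poly_eq_0_iff_dvd)
      have "q \<noteq> 0" using q less.prems(1) by auto
      then have deg: "degree q < degree f" unfolding q by (subst degree_mult_eq) auto
      let ?u = "sj_y - sj_const \<alpha>" and ?v = "sj_poly sj_y q"
      have uv: "?u * ?v \<in> P" using less.prems(2) unfolding q sj_poly_y_linear_mult .
      have "?u * r * ?v \<in> P" for r
      proof -
        \<comment> \<open>Both products have the same image in the commutative ring
          \<open>k[y]\<close>, so they agree modulo \<open>P\<close>.\<close>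
        have "?u * r * ?v - r * (?u * ?v) \<in> P"
          by (rule subsetD[OF line]) (simp add: algebra_simps)
        from ideal_add[OF I this ideal_mult_left[OF I uv, of r]] show ?thesis by simp
      qed
      with prime have "?u \<in> P \<or> ?v \<in> P" by blast
      with less.hyps[OF deg \<open>q \<noteq> 0\<close>] show ?thesis by blast
    qed
  qed
  have "\<exists>\<alpha>. P = {a. poly (sj_eval a) \<alpha> = 0}" if notline: "\<not> P \<subseteq> {a. sj_eval a = 0}"
  proof -
    obtain a where a: "a \<in> P" "sj_eval a \<noteq> 0" using notline by blast
    have "a - (a - sj_poly sj_y (sj_eval a)) \<in> P"
      by (rule ideal_diff[OF I a(1) diff_sj_poly_eval_mem[OF I x]])
    then obtain \<alpha> where \<alpha>: "sj_y - sj_const \<alpha> \<in> P" using linear[OF a(2)] by auto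
    have "{a. poly (sj_eval a) \<alpha> = 0} \<subseteq> P"
      unfolding Idl_s_x_y_eq[symmetric] by (rule Idl_subset[OF I]) (use s x \<alpha> in auto)
    then show ?thesis
      using maximalideal.I_maximal[OF maximalideal_point I] proper by auto
  qed
  with line show ?thesis by blast
qed

section \<open>The prime, primitive and maximal spectra\<close>

theorem theorem3p2:
  fixes J :: "'k :: {alg_closed_field, field_char_0} super_jordan ring"
  assumes J_def: "J = super_jordan_plane"
  shows "prime_spectrum J =
           {Idl\<^bsub>J\<^esub> {0}, Idl\<^bsub>J\<^esub> {sj_s, sj_x}} \<union>
           {Idl\<^bsub>J\<^esub> {sj_s, sj_x, sj_y - sj_const \<alpha>} | \<alpha>. True} \<and>
         (\<forall>P. prime_ideal J P \<and> P \<noteq> {0} \<longrightarrow> completely_prime_ideal J P) \<and>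
         primitive_spectrum J =
           {Idl\<^bsub>J\<^esub> {0}} \<union> {Idl\<^bsub>J\<^esub> {sj_s, sj_x, sj_y - sj_const \<alpha>} | \<alpha>. True} \<and>
         maximal_spectrum J = {Idl\<^bsub>J\<^esub> {sj_s, sj_x, sj_y - sj_const \<alpha>} | \<alpha>. True}"
proof -
  let ?K = "{a :: 'k super_jordan. sj_eval a = 0}"
  let ?M = "\<lambda>\<alpha>. {a :: 'k super_jordan. poly (sj_eval a) \<alpha> = 0}"
  have J: "J = ring_of_type_algebra" by (simp add: J_def super_jordan_plane_def)
  have zero: "Idl\<^bsub>J\<^esub> {0} = {0}"
    using ring.genideal_zero[OF ring_ring_of_type_algebra] by (simp add: J)
  have primitive_imp_prime: "prime_ideal J P" if "primitive_ideal J P" for P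
    using that simple_left_module.prime_ideal_annihilator unfolding primitive_ideal_def by blast
  have zero_primitive: "primitive_ideal J {0}" using primitive_ideal_zero by (simp add: J)
  have completely: "completely_prime_ideal J ?K" "completely_prime_ideal J (?M \<alpha>)" for \<alpha>
    using completely_prime_ideal_line completely_prime_ideal_point by (auto simp: J)
  have prime: "prime_ideal J P \<longleftrightarrow> P = {0} \<or> P = ?K \<or> (\<exists>\<alpha>. P = ?M \<alpha>)" for P
  proof
    show "prime_ideal J P \<Longrightarrow> P = {0} \<or> P = ?K \<or> (\<exists>\<alpha>. P = ?M \<alpha>)"
      using nonzero_prime_classification[of P] by (auto simp: J)
    show "P = {0} \<or> P = ?K \<or> (\<exists>\<alpha>. P = ?M \<alpha>) \<Longrightarrow> prime_ideal J P"
      using completely primitive_imp_prime[OF zero_primitive]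
      by (auto simp: completely_prime_ideal_def)
  qed
  \<comment> \<open>Primitive ideals are prime, so among the listed primes only the line has to be
    excluded.\<close>
  have primitive: "primitive_ideal J P \<longleftrightarrow> P = {0} \<or> (\<exists>\<alpha>. P = ?M \<alpha>)" for P
    using prime[of P] primitive_imp_prime[of P] zero_primitive not_primitive_ideal_line
      primitive_ideal_point unfolding J by blast
  \<comment> \<open>Maximal ideals are prime, and \<open>{0}\<close>, \<open>?K\<close>,
    \<open>?M 0\<close> form a strictly increasing chain of proper ideals, which excludes the first
    two.\<close>
  have maximal: "maximalideal P J \<longleftrightarrow> (\<exists>\<alpha>. P = ?M \<alpha>)" for P
  proof
    assume P: "maximalideal P J"
    have ideals: "ideal ?K J" "ideal (?M 0) J"
      using completely by (auto simp: completely_prime_ideal_def prime_ideal_def)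
    have "P \<noteq> {0}"
    proof
      assume "P = {0}"
      then have "?K = {0} \<or> ?K = UNIV"
        using maximalideal.I_maximal[OF P ideals(1)] by (auto simp: J)
      moreover have "sj_s \<in> ?K" "1 \<notin> ?K" by auto
      ultimately show False using sj_s_neq_0 by blast
    qed
    moreover have "P \<noteq> ?K"
    proof
      assume "P = ?K"
      moreover have "?K \<subseteq> ?M 0" by auto
      ultimately have "?M 0 = ?K \<or> ?M 0 = UNIV"
        using maximalideal.I_maximal[OF P ideals(2)] by (simp add: J)
      moreover have "sj_y \<in> ?M 0" "sj_y \<notin> ?K" "1 \<notin> ?M 0" by auto
      ultimately show False by blast
    qed
    moreover have "prime_ideal J P" using maximalideal_imp_prime_ideal P by (simp add: J)
    ultimately show "\<exists>\<alpha>. P = ?M \<alpha>" using prime by blast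
  qed (use maximalideal_point in \<open>auto simp: J\<close>)
  have line: "Idl\<^bsub>J\<^esub> {sj_s, sj_x} = ?K"
    and point: "Idl\<^bsub>J\<^esub> {sj_s, sj_x, sj_y - sj_const \<alpha>} = ?M \<alpha>" for \<alpha>
    by (simp_all add: J Idl_s_x_eq Idl_s_x_y_eq)
  have families: "{P. P = A \<or> P = B \<or> (\<exists>\<alpha>. P = C \<alpha>)} = {A, B} \<union> {C \<alpha> | \<alpha>. True}"
    "{P. P = A \<or> (\<exists>\<alpha>. P = C \<alpha>)} = {A} \<union> {C \<alpha> | \<alpha>. True}"
    "{P. \<exists>\<alpha>. P = C \<alpha>} = {C \<alpha> | \<alpha>. True}"
    for A B :: "'k super_jordan set" and C :: "'k \<Rightarrow> 'k super_jordan set"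
    by auto
  have nonzero: "completely_prime_ideal J P" if "prime_ideal J P" "P \<noteq> {0}" for P
    using that(2) that(1)[unfolded prime] completely by metis
  have "prime_spectrum J = {Idl\<^bsub>J\<^esub> {0}, Idl\<^bsub>J\<^esub> {sj_s, sj_x}} \<union>
      {Idl\<^bsub>J\<^esub> {sj_s, sj_x, sj_y - sj_const \<alpha>} | \<alpha>. True}"
    unfolding prime_spectrum_def zero line point prime families ..
  moreover have "primitive_spectrum J =
      {Idl\<^bsub>J\<^esub> {0}} \<union> {Idl\<^bsub>J\<^esub> {sj_s, sj_x, sj_y - sj_const \<alpha>} | \<alpha>. True}"
    unfolding primitive_spectrum_def zero point primitive families ..
  moreover have "maximal_spectrum J = {Idl\<^bsub>J\<^esub> {sj_s, sj_x, sj_y - sj_const \<alpha>} | \<alpha>. True}"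
    unfolding maximal_spectrum_def point maximal families ..
  ultimately show ?thesis using nonzero by simp
qed

end
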